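(* Let $X$ be a $\mathbb{Z}^2$-subshift whose set of nonexpansive rays (up to translation) is finite and nonempty, and such that each nonexpansive ray is rational and closing. Then $X$ can be recoded to be a polygonal shift with a coding polygon $\mathcal{P}$ such that each oriented edge of $\mathcal{P}$ is positively parallel to one of the nonexpansive rays and each nonexpansive ray is positively parallel to an edge of $\mathcal{P}$.
   Context: Subshifts and coding. For a finite alphabet $\mathcal{A}$ (discrete topology), a $\mathbb{Z}^2$-subshift is a closed subset $X\subset\mathcal{A}^{\mathbb{Z}^2}$ (product topology) invariant under the shifts $(T^ux)(v)=x(u+v)$, $u\in\mathbb{Z}^2$. For $A,B\subset\mathbb{R}^2$, $A$ $X$-codes $B$ if whenever $x,x'\in X$ agree on $A\cap\mathbb{Z}^2$ they agree on $B\cap\mathbb{Z}^2$. Recoding. A $\mathbb{Z}^2$-subshift $Y$ (possibly over another finite alphabet) is a recoding of $X$ (and $X$ can be recoded to $Y$) if there are a finite set $F\subset\mathbb{Z}^2$ and a homeomorphism $\Psi:X\to Y$ commuting with the shift actions such that for all $(i,j)\in\mathbb{Z}^2$ and $x,x'\in X$: $\Psi(x)(i,j)=\Psi(x')(i,j)$ if and only if $x$ and $x'$ agree on $F+(i,j)$. Polygons. An integer polygon is a polygon in $\mathbb{R}^2$ (including its interior) with all vertices in $\mathbb{Z}^2$. A convex integer polygon $\mathcal{P}$ is a coding polygon for an infinite $\mathbb{Z}^2$-subshift $X$ if for every vertex $v$ of $\mathcal{P}$, $\mathcal{P}\setminus\{v\}$ $X$-codes $\{v\}$. $X$ is polygonal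 if it is infinite and has a coding polygon. Degenerate polygons are allowed: a line segment with distinct endpoints in $\mathbb{Z}^2$ is regarded as a polygon with two vertices (its endpoints) and two edges (the segment with each of its two orientations). The edges of a polygon carry the boundary (counterclockwise) orientation. Rays. A ray is a translate of $\{tv: t\ge 0\}$, $v\neq0$ in $\mathbb{R}^2$, oriented in the direction of increasing $t$; it is rational if its slope is rational or infinite. Two rays are positively parallel if one is a translate of the other; an oriented line segment is positively parallel to a ray if a translate of it lies in the ray with matching orientation. A half space $H\subset\mathbb{R}^2$ (open or closed half plane) is expansive for $X$ if $H$ $X$-codes $\mathbb{R}^2$, and nonexpansive otherwise; this depends only on $H$ up to translation. A ray $\ell$ is expansive (nonexpansive) for $X$ if the half space $H$ bounded by the line containing $\ell$ and lying to the left of $\ell$ (so that $\ell$ has the orientation that $\partial H$ inherits from $H$) is expansive (nonexpansive). Closing. Let $L$ be a one-dimensional subspace of $\mathbb{R}^2$ of rational slope bounding a nonexpansive closed half space $H$, and let $L_0$ be the line in the complement of $H$ closest to $L$ among lines of the form $z+L$, $z\in\mathbb{Z}^2$. A block in $L_0\cap\mathbb{Z}^2$ is the intersection of $\mathbb{Z}^2$ with a connected segment of $L_0$. $H$ is closing if there is $N>0$ such that for every block $\mathcal{B}$ in $L_0\cap\mathbb{Z}^2$ of length at least $N$, $H\cup\mathcal{B}$ $X$-codes $H\cup L_0$. A ray in $L$ with the orientation $L=\partial H$ inherits from $H$ (i.e. $H$ lies to its left) is then called closing. *)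

theory Defs
  imports "HOL-Analysis.Analysis"
begin

subsection \<open>Subshifts, coding and recoding\<close>

text \<open>
  Alphabets are explicit finite sets, so that one can quantify over the alphabet of a recoding:
  every finite alphabet is, up to renaming symbols, a finite set of natural numbers.
\<close>

type_synonym 'a config = "int \<times> int \<Rightarrow> 'a"

definition full_shift :: "'a set \<Rightarrow> 'a config topology" where
  "full_shift A = product_topology (\<lambda>_. discrete_topology A) UNIV"

definition shift :: "int \<times> int \<Rightarrow> 'a config \<Rightarrow> 'a config" where
  "shift u x = (\<lambda>v. x (u + v))"

definition subshift :: "'a set \<Rightarrow> 'a config set \<Rightarrow> bool" where
  "subshift A X \<longleftrightarrow> finite A \<and> closedin (full_shift A) X \<and> (\<forall>u. shift u ` X = X)"

definition to_plane :: "int \<times> int \<Rightarrow> real \<times> real" where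
  "to_plane u = (of_int (fst u), of_int (snd u))"

abbreviation lattice :: "(real \<times> real) set" where
  "lattice \<equiv> range to_plane"

definition codes :: "'a config set \<Rightarrow> (real \<times> real) set \<Rightarrow> (real \<times> real) set \<Rightarrow> bool" where
  "codes X S T \<longleftrightarrow>
     (\<forall>x\<in>X. \<forall>x'\<in>X. (\<forall>u. to_plane u \<in> S \<longrightarrow> x u = x' u) \<longrightarrow> (\<forall>u. to_plane u \<in> T \<longrightarrow> x u = x' u))"

definition recoding :: "'a set \<Rightarrow> 'a config set \<Rightarrow> 'b set \<Rightarrow> 'b config set \<Rightarrow> bool" where
  "recoding A X B Y \<longleftrightarrow>
     subshift A X \<and> subshift B Y \<and>
     (\<exists>F \<Psi>. finite F \<and>
        homeomorphic_map (subtopology (full_shift A) X) (subtopology (full_shift B) Y) \<Psi> \<and>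
        (\<forall>u. \<forall>x\<in>X. \<Psi> (shift u x) = shift u (\<Psi> x)) \<and>
        (\<forall>u. \<forall>x\<in>X. \<forall>x'\<in>X. \<Psi> x u = \<Psi> x' u \<longleftrightarrow> (\<forall>f\<in>F. x (f + u) = x' (f + u))))"


subsection \<open>Rays and half planes\<close>

definition ray :: "real \<times> real \<Rightarrow> real \<times> real \<Rightarrow> (real \<times> real) set" where
  "ray p v = {p + t *\<^sub>R v | t. t \<ge> 0}"

definition rational_ray :: "(real \<times> real) set \<Rightarrow> bool" where
  "rational_ray l \<longleftrightarrow> (\<exists>p v. v \<noteq> 0 \<and> l = ray p v \<and> (fst v = 0 \<or> snd v / fst v \<in> \<rat>))"

definition cross2 :: "real \<times> real \<Rightarrow> real \<times> real \<Rightarrow> real" where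
  "cross2 v w = fst v * snd w - snd v * fst w"

definition left_halfplane :: "real \<times> real \<Rightarrow> real \<times> real \<Rightarrow> (real \<times> real) set" where
  "left_halfplane p v = {q. cross2 v (q - p) \<ge> 0}"

definition expansive :: "'a config set \<Rightarrow> (real \<times> real) set \<Rightarrow> bool" where
  "expansive X H \<longleftrightarrow> codes X H UNIV"

text \<open>
  A ray determines its origin, and its direction up to a positive factor, so the choice of
  \<open>p\<close> and \<open>v\<close> below does not matter.  The half plane is taken closed; for a subshift the open
  one gives the same notion, as each contains an integer translate of the other.
\<close>

definition nonexpansive_rays :: "'a config set \<Rightarrow> (real \<times> real) set set" where
  "nonexpansive_rays X =
     {l. \<exists>p v. v \<noteq> 0 \<and> l = ray p v \<and> \<not> expansive X (left_halfplane p v)}"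

definition translation_rel :: "((real \<times> real) set \<times> (real \<times> real) set) set" where
  "translation_rel = {(S, T). \<exists>w. T = (\<lambda>p. w + p) ` S}"


subsection \<open>Closing half planes\<close>

definition next_line ::
  "(real \<times> real) set \<Rightarrow> (real \<times> real) set \<Rightarrow> (real \<times> real) set \<Rightarrow> bool" where
  "next_line L H L0 \<longleftrightarrow>
     (let lines = {M. (\<exists>z\<in>lattice. M = (\<lambda>p. z + p) ` L) \<and> M \<inter> H = {}}
      in L0 \<in> lines \<and> (\<forall>M\<in>lines. setdist L L0 \<le> setdist L M))"

definition block :: "(real \<times> real) set \<Rightarrow> (real \<times> real) set \<Rightarrow> bool" where
  "block L0 K \<longleftrightarrow> (\<exists>a\<in>L0. \<exists>b\<in>L0. K = lattice \<inter> closed_segment a b)"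

text \<open>
  The length of a block is its number of lattice points.  If \<open>L\<close> has irrational slope, no closest
  line exists and the condition fails; otherwise the line \<open>L0\<close> is unique.
\<close>

definition closing_halfplane ::
  "'a config set \<Rightarrow> (real \<times> real) set \<Rightarrow> (real \<times> real) set \<Rightarrow> bool" where
  "closing_halfplane X L H \<longleftrightarrow>
     \<not> expansive X H \<and>
     (\<exists>L0. next_line L H L0 \<and>
        (\<exists>N::nat. N > 0 \<and> (\<forall>K. block L0 K \<and> card K \<ge> N \<longrightarrow> codes X (H \<union> K) (H \<union> L0))))"

text \<open>
  Closing is defined for half planes bounded by a line through the origin; a ray elsewhere in the
  plane is closing if its translates in that line are.
\<close>

definition closing_ray :: "'a config set \<Rightarrow> (real \<times> real) set \<Rightarrow> bool" where
  "closing_ray X l \<longleftrightarrow>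
     (\<exists>p v. v \<noteq> 0 \<and> l = ray p v \<and> closing_halfplane X (span {v}) (left_halfplane 0 v))"


subsection \<open>Coding polygons\<close>

text \<open>
  A polygon is two-dimensional or a nondegenerate segment; a single point is excluded.
\<close>

definition convex_integer_polygon :: "(real \<times> real) set \<Rightarrow> bool" where
  "convex_integer_polygon P \<longleftrightarrow>
     polytope P \<and> aff_dim P \<ge> 1 \<and> (\<forall>v. v extreme_point_of P \<longrightarrow> v \<in> lattice)"

definition coding_polygon :: "'a config set \<Rightarrow> (real \<times> real) set \<Rightarrow> bool" where
  "coding_polygon X P \<longleftrightarrow>
     infinite X \<and> convex_integer_polygon P \<and>
     (\<forall>v. v extreme_point_of P \<longrightarrow> codes X (P - {v}) {v})"

definition polygonal :: "'a config set \<Rightarrow> bool" where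
  "polygonal X \<longleftrightarrow> infinite X \<and> (\<exists>P. coding_polygon X P)"

text \<open>
  The edge from \<open>a\<close> to \<open>b\<close> is counterclockwise if \<open>P\<close> lies to its left.  When \<open>P\<close> is the
  segment from \<open>a\<close> to \<open>b\<close>, this holds for both orientations.
\<close>

definition oriented_edge :: "(real \<times> real) set \<Rightarrow> real \<times> real \<Rightarrow> real \<times> real \<Rightarrow> bool" where
  "oriented_edge P a b \<longleftrightarrow>
     a \<noteq> b \<and> closed_segment a b edge_of P \<and> P \<subseteq> left_halfplane a (b - a)"

definition segment_parallel_ray ::
  "real \<times> real \<Rightarrow> real \<times> real \<Rightarrow> (real \<times> real) set \<Rightarrow> bool" where
  "segment_parallel_ray a b l \<longleftrightarrow>
     (\<exists>p v w s t. v \<noteq> 0 \<and> l = ray p v \<and> 0 \<le> s \<and> s < t \<and>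
        w + a = p + s *\<^sub>R v \<and> w + b = p + t *\<^sub>R v)"

end

theory Submission
  imports Defs
begin

text \<open>
  Recode \<open>X\<close> with a large disc \<open>D\<close> as window, and let \<open>P\<close> be a lattice polygon with long edges whose
  edge directions are the nonexpansive ones.  At a vertex \<open>p\<close> one must show that the union of the
  discs centred at the other lattice points of \<open>P\<close> codes the disc centred at \<open>p\<close>.  If this failed for
  arbitrarily large discs, then recentring at the uncoded points and passing to a limit would give
  a half plane, with normal \<open>n\<close> in the normal cone of \<open>P\<close> at \<open>p\<close>, which does not code the origin on its
  boundary.  For \<open>n\<close> in the interior of the cone this half plane is expansive; if \<open>n\<close> is normal to an
  edge, the lattice points of the edge supply a block and the closing condition applies.

  Such a polygon exists if no closed half plane contains all nonexpansive directions with one of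
  them in its interior.  Otherwise the same limit argument gives a finite set which codes its
  translate by some \<open>w\<close>; the pattern on it then determines all its translates by multiples of \<open>w\<close>
  in both directions, and every half plane whose boundary is not parallel to \<open>w\<close> is expansive.
\<close>

section \<open>Lattice coding and compactness\<close>

text \<open>A large circle looks straight in every direction, which is why the window is a disc:
  seen from an uncoded point, the discs about the other centres fill in the limit an open half
  plane, and since all discs have the same radius they also contain the translates of the centres
  themselves. In a nonexpansive direction the open half plane alone does not suffice; these extra
  points supply the block that closing asks for.

  The constants depend on each other in one order only: the block length \<open>N\<close> on the
  finitely many directions, the polygon on \<open>N\<close>, the radius on the polygon and its
  finitely many vertices.

  Since \<open>v\<close> may be nonexpansive while \<open>- v\<close> is not, a centrally symmetric
  polygon, such as the zonotope spanned by the directions, can have unwanted edges. The polygon is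
  instead, unless all directions are parallel, an intersection of half planes, one for each
  nonexpansive direction; its boundedness is the reason to show that each \<open>- v\<close> lies in
  the cone spanned by two nonexpansive directions.\<close>

definition icodes :: "'a config set \<Rightarrow> (int \<times> int) set \<Rightarrow> (int \<times> int) set \<Rightarrow> bool" where
  "icodes X S T \<longleftrightarrow>
     (\<forall>x\<in>X. \<forall>x'\<in>X. (\<forall>u\<in>S. x u = x' u) \<longrightarrow> (\<forall>u\<in>T. x u = x' u))"

lemma icodesD: "icodes X S T \<Longrightarrow> x \<in> X \<Longrightarrow> x' \<in> X \<Longrightarrow> (\<And>u. u \<in> S \<Longrightarrow> x u = x' u) \<Longrightarrow> u \<in> T \<Longrightarrow> x u = x' u"
  by (simp add: icodes_def)

lemma icodes_mono: "icodes X S T \<Longrightarrow> S \<subseteq> S' \<Longrightarrow> T' \<subseteq> T \<Longrightarrow> icodes X S' T'"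
  unfolding icodes_def by (meson subset_iff)

lemma codes_eq_icodes: "codes X S T \<longleftrightarrow> icodes X (to_plane -` S) (to_plane -` T)"
  by (simp add: codes_def icodes_def Ball_def)

lemma shift_in: "subshift A X \<Longrightarrow> x \<in> X \<Longrightarrow> shift u x \<in> X"
  unfolding subshift_def by blast

lemma icodes_translate:
  assumes "subshift A X" "icodes X S T"
  shows "icodes X ((+) w ` S) ((+) w ` T)"
  unfolding icodes_def
proof (intro ballI impI)
  fix x x' u assume x: "x \<in> X" "x' \<in> X" "\<forall>u\<in>(+) w ` S. x u = x' u" "u \<in> (+) w ` T"
  then obtain t where t: "u = w + t" "t \<in> T" by auto
  have "shift w x t = shift w x' t"
    by (rule icodesD[OF assms(2)]) (use x t shift_in[OF assms(1)] in \<open>auto simp: shift_def\<close>)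
  then show "x u = x' u" by (simp add: shift_def t)
qed

section \<open>Compactness and finite coding sets\<close>

lemma subshift_value: "subshift A X \<Longrightarrow> x \<in> X \<Longrightarrow> x v \<in> A"
  unfolding subshift_def using closedin_subset[of "full_shift A" X] by (force simp: full_shift_def PiE_iff)

lemma topspace_subshift: "subshift A X \<Longrightarrow> topspace (subtopology (full_shift A) X) = X"
  unfolding subshift_def using closedin_subset[of "full_shift A" X] by auto

lemma compact_subshift: "subshift A X \<Longrightarrow> compact_space (subtopology (full_shift A) X)"
  unfolding subshift_def
  by (auto simp: full_shift_def compact_space_product_topology compact_space_discrete_topology
      intro!: compact_space_subtopology closedin_compact_space)

lemma continuous_map_coordinate:
  "continuous_map (subtopology (full_shift A) X) (discrete_topology A) (\<lambda>x. x v)"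
  unfolding full_shift_def by (intro continuous_map_from_subtopology continuous_map_product_projection) auto

lemma openin_pair_coordinates:
  assumes "subshift A X"
  shows "openin (prod_topology (subtopology (full_shift A) X) (subtopology (full_shift A) X))
           {p \<in> X \<times> X. (fst p v, snd p v) \<in> W}"
proof -
  let ?T = "subtopology (full_shift A) X"
  have "continuous_map (prod_topology ?T ?T) (prod_topology (discrete_topology A) (discrete_topology A))
          (\<lambda>p. (fst p v, snd p v))"
    using continuous_map_compose[OF continuous_map_fst continuous_map_coordinate[of A X v], of ?T]
      continuous_map_compose[OF continuous_map_snd continuous_map_coordinate[of A X v], of ?T]
    by (auto simp: continuous_map_pairwise o_def)
  then have "openin (prod_topology ?T ?T)
     {p \<in> topspace (prod_topology ?T ?T). (fst p v, snd p v) \<in> W \<inter> A \<times> A}"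
    by (rule openin_continuous_map_preimage)
       (simp flip: prod_topology_discrete_topology)
  also have "{p \<in> topspace (prod_topology ?T ?T). (fst p v, snd p v) \<in> W \<inter> A \<times> A}
     = {p \<in> X \<times> X. (fst p v, snd p v) \<in> W}"
    using topspace_subshift[OF assms] by (auto intro: subshift_value[OF assms])
  finally show ?thesis .
qed

text \<open>The pairs that agree at \<open>u\<close>, and the pairs that disagree at a given point
  of \<open>S\<close>, form open sets. Coding says that together they cover the compact space of
  pairs; a finite subcover names the points of \<open>T\<close>.\<close>

lemma finite_coding_set:
  assumes X: "subshift A X" and "icodes X S {u}"
  obtains T where "T \<subseteq> S" "finite T" "icodes X T {u}"
proof -
  let ?T = "subtopology (full_shift A) X"
  define U where "U s = {p \<in> X \<times> X. (fst p s, snd p s) \<in> {(a, b). a \<noteq> b}}" for s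
  define E where "E = {p \<in> X \<times> X. (fst p u, snd p u) \<in> {(a, b). a = b}}"
  have "compact_space (prod_topology ?T ?T)"
    using compact_subshift[OF X] by (simp add: compact_space_prod_topology)
  moreover have "\<forall>V\<in>insert E (U ` S). openin (prod_topology ?T ?T) V"
    unfolding E_def U_def using openin_pair_coordinates[OF X] by blast
  moreover have "topspace (prod_topology ?T ?T) \<subseteq> \<Union>(insert E (U ` S))"
  proof
    fix p assume "p \<in> topspace (prod_topology ?T ?T)"
    then have p: "p \<in> X \<times> X" by auto
    show "p \<in> \<Union>(insert E (U ` S))"
    proof (cases "\<exists>s\<in>S. fst p s \<noteq> snd p s")
      case True
      then show ?thesis using p by (auto simp: U_def)
    next
      case False
      then have "fst p u = snd p u"
        using icodesD[OF assms(2), of "fst p" "snd p" u] p by auto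
      then show ?thesis using p by (auto simp: E_def)
    qed
  qed
  ultimately obtain F where F: "finite F" "F \<subseteq> insert E (U ` S)" "X \<times> X \<subseteq> \<Union>F"
    unfolding compact_space_alt by (metis topspace_prod_topology topspace_subshift[OF X])
  have "finite (F - {E})" "F - {E} \<subseteq> U ` S" using F by auto
  then obtain T where T: "T \<subseteq> S" "finite T" "F - {E} = U ` T"
    by (meson finite_subset_image)
  have "icodes X T {u}"
    unfolding icodes_def
  proof (intro ballI impI)
    fix x x' w assume x: "x \<in> X" "x' \<in> X" "\<forall>t\<in>T. x t = x' t" "w \<in> {u}"
    then have "(x, x') \<in> \<Union>F" "(x, x') \<notin> \<Union>(F - {E})" using F(3) by (auto simp: T(3) U_def)
    then have "(x, x') \<in> E" by blast
    then show "x w = x' w" using x by (auto simp: E_def)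
  qed
  with T that show ?thesis by blast
qed

lemma Hausdorff_full_shift: "Hausdorff_space (full_shift A)"
  unfolding full_shift_def by (simp add: Hausdorff_space_product_topology)

text \<open>The symbol at \<open>u\<close> is a number naming the pattern on \<open>F + u\<close>,
  so equality of symbols is agreement on that window. Membership of \<open>0\<close> in
  \<open>F\<close> makes the map injective, and a continuous injection of a compact space into a
  Hausdorff space is a homeomorphism onto its image.\<close>

lemma block_recoding:
  assumes X: "subshift A X" and F: "finite F" "0 \<in> F"
  obtains B :: "nat set" and \<Psi> where
    "recoding A X B (\<Psi> ` X)" "inj_on \<Psi> X"
    "\<And>u x x'. x \<in> X \<Longrightarrow> x' \<in> X \<Longrightarrow> \<Psi> x u = \<Psi> x' u \<longleftrightarrow> (\<forall>f\<in>F. x (f + u) = x' (f + u))"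
proof -
  have "finite (F \<rightarrow>\<^sub>E A)" using F X by (auto simp: subshift_def intro: finite_PiE)
  then obtain enc :: "_ \<Rightarrow> nat" where enc: "inj_on enc (F \<rightarrow>\<^sub>E A)"
    using finite_imp_inj_to_nat_seg by blast
  define \<Psi> where "\<Psi> x u = enc (restrict (\<lambda>f. x (f + u)) F)" for x :: "'a config" and u
  define B where "B = enc ` (F \<rightarrow>\<^sub>E A)"
  let ?T = "subtopology (full_shift A) X"
  have pat: "restrict (\<lambda>f. x (f + u)) F \<in> F \<rightarrow>\<^sub>E A" if "x \<in> X" for x u
    using subshift_value[OF X that] by auto
  have inB: "\<Psi> x u \<in> B" if "x \<in> X" for x u
    unfolding \<Psi>_def B_def using pat[OF that] by blast
  have eq: "\<Psi> x u = \<Psi> x' u \<longleftrightarrow> (\<forall>f\<in>F. x (f + u) = x' (f + u))" if "x \<in> X" "x' \<in> X" for u x x'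
  proof -
    have "\<Psi> x u = \<Psi> x' u \<longleftrightarrow> restrict (\<lambda>f. x (f + u)) F = restrict (\<lambda>f. x' (f + u)) F"
      unfolding \<Psi>_def by (rule inj_on_eq_iff[OF enc pat[OF that(1)] pat[OF that(2)]])
    then show ?thesis by (auto simp: fun_eq_iff restrict_def)
  qed
  have inj: "inj_on \<Psi> X"
  proof (rule inj_onI)
    fix x x' assume x: "x \<in> X" "x' \<in> X" "\<Psi> x = \<Psi> x'"
    show "x = x'"
    proof
      fix u from eq[OF x(1,2), of u] x(3) F(2) have "x (0 + u) = x' (0 + u)" by (metis (no_types))
      then show "x u = x' u" by simp
    qed
  qed
  have comm: "\<Psi> (shift u x) = shift u (\<Psi> x)" for u x
    by (simp add: \<Psi>_def shift_def fun_eq_iff algebra_simps)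
  have open1: "openin ?T {x \<in> X. x v \<in> W}" for v W
    using openin_continuous_map_preimage[OF continuous_map_coordinate[of A X v], of "W \<inter> A"]
      topspace_subshift[OF X]
    by (auto intro: subshift_value[OF X] elim!: back_subst[of "openin ?T"])
  have cont_u: "continuous_map ?T (discrete_topology B) (\<lambda>x. \<Psi> x u)" for u
    unfolding continuous_map_def
  proof (intro conjI allI impI)
    fix W
    show "openin ?T {x \<in> topspace ?T. \<Psi> x u \<in> W}"
    proof (subst openin_subopen, intro ballI)
      fix x0 assume "x0 \<in> {x \<in> topspace ?T. \<Psi> x u \<in> W}"
      then have x0: "x0 \<in> X" "\<Psi> x0 u \<in> W" using topspace_subshift[OF X] by auto
      define N where "N = (\<Inter>f\<in>F. {x \<in> X. x (f + u) \<in> {x0 (f + u)}})"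
      have "openin ?T N"
        unfolding N_def
      proof (intro openin_Inter)
        fix V assume "V \<in> (\<lambda>f. {x \<in> X. x (f + u) \<in> {x0 (f + u)}}) ` F"
        then show "openin ?T V" using open1 by blast
      qed (use F in auto)
      moreover have "x0 \<in> N" using x0 by (auto simp: N_def)
      moreover have "N \<subseteq> {x \<in> topspace ?T. \<Psi> x u \<in> W}"
      proof
        fix x assume xN: "x \<in> N"
        then have "x \<in> X" using F by (auto simp: N_def)
        moreover have "\<Psi> x u = \<Psi> x0 u" using xN eq[OF \<open>x \<in> X\<close> x0(1)] by (auto simp: N_def)
        ultimately show "x \<in> {x \<in> topspace ?T. \<Psi> x u \<in> W}"
          using x0 topspace_subshift[OF X] by auto
      qed
      ultimately show "\<exists>T. openin ?T T \<and> x0 \<in> T \<and> T \<subseteq> {x \<in> topspace ?T. \<Psi> x u \<in> W}" by blast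
    qed
  qed (use inB topspace_subshift[OF X] in auto)
  have cont: "continuous_map ?T (full_shift B) \<Psi>"
    unfolding full_shift_def[of B] continuous_map_componentwise_UNIV using cont_u by blast
  have "compactin (full_shift B) (\<Psi> ` X)"
    by (rule image_compactin[OF _ cont]) (metis X compact_space_def compact_subshift topspace_subshift)
  then have closed: "closedin (full_shift B) (\<Psi> ` X)"
    using compactin_imp_closedin[OF Hausdorff_full_shift] by blast
  have shY: "shift u ` \<Psi> ` X = \<Psi> ` X" for u
    using X unfolding subshift_def by (metis (no_types, lifting) comm image_comp image_cong o_apply)
  have subY: "subshift B (\<Psi> ` X)"
    unfolding subshift_def B_def[symmetric] using closed shY \<open>finite (F \<rightarrow>\<^sub>E A)\<close> by (auto simp: B_def)
  have "homeomorphic_map ?T (subtopology (full_shift B) (\<Psi> ` X)) \<Psi>"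
  proof (rule continuous_imp_homeomorphic_map)
    show "continuous_map ?T (subtopology (full_shift B) (\<Psi> ` X)) \<Psi>"
      using cont topspace_subshift[OF X] by (auto simp: continuous_map_in_subtopology)
    show "Hausdorff_space (subtopology (full_shift B) (\<Psi> ` X))"
      by (simp add: Hausdorff_full_shift Hausdorff_space_subtopology)
  qed (use topspace_subshift[OF X] topspace_subshift[OF subY] inj compact_subshift[OF X] in auto)
  then have "recoding A X B (\<Psi> ` X)"
    unfolding recoding_def
    by (intro conjI exI[of _ F] exI[of _ \<Psi>] allI ballI X subY F(1)) (simp_all only: comm eq)
  then show thesis by (rule that[OF _ inj eq])
qed

section \<open>Windows shaped like large discs\<close>

lemma to_plane_simps [simp]:
  "to_plane (u + w) = to_plane u + to_plane w"
  "to_plane (u - w) = to_plane u - to_plane w"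
  "to_plane (- u) = - to_plane u"
  "to_plane 0 = 0"
  by (simp_all add: to_plane_def prod_eq_iff)

lemma to_plane_inject [simp]: "to_plane u = to_plane w \<longleftrightarrow> u = w"
  by (simp add: to_plane_def prod_eq_iff)

lemma finite_lattice_bounded:
  assumes "bounded S"
  shows "finite {u. to_plane u \<in> S}"
proof -
  obtain B where B: "\<And>x. x \<in> S \<Longrightarrow> norm x \<le> B" using assms unfolding bounded_iff by blast
  have "{u. to_plane u \<in> S} \<subseteq> {- \<lceil>B\<rceil>..\<lceil>B\<rceil>} \<times> {- \<lceil>B\<rceil>..\<lceil>B\<rceil>}"
  proof
    fix u assume "u \<in> {u. to_plane u \<in> S}"
    then have n: "norm (to_plane u) \<le> B" using B by auto
    have "norm (fst (to_plane u)) \<le> B" "norm (snd (to_plane u)) \<le> B"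
      using n norm_fst_le[of "fst (to_plane u)" "snd (to_plane u)"] norm_snd_le[of "snd (to_plane u)" "fst (to_plane u)"]
      by simp_all
    then show "u \<in> {- \<lceil>B\<rceil>..\<lceil>B\<rceil>} \<times> {- \<lceil>B\<rceil>..\<lceil>B\<rceil>}"
      unfolding to_plane_def mem_Times_iff by simp linarith
  qed
  then show ?thesis using finite_subset by blast
qed

definition disc :: "real \<Rightarrow> (int \<times> int) set" where
  "disc r = {u. norm (to_plane u) \<le> r}"

lemma in_translated_disc: "w \<in> (+) z ` disc r \<longleftrightarrow> norm (to_plane w - to_plane z) \<le> r"
proof
  assume "norm (to_plane w - to_plane z) \<le> r"
  then have "w - z \<in> disc r" by (simp add: disc_def)
  then have "z + (w - z) \<in> (+) z ` disc r" by (rule imageI)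
  then show "w \<in> (+) z ` disc r" by simp
qed (auto simp: disc_def)

lemma finite_disc: "finite (disc r)"
  using finite_lattice_bounded[of "cball 0 r"] by (simp add: disc_def)

text \<open>If the discs of radius tending to infinity all fail, the missing lattice points, seen from
  the centre, have a limit direction \<open>n\<close>; recentred at these points the translated discs exhaust
  a half plane with normal \<open>n\<close>, whatever lattice points they contain on its boundary being those
  of \<open>Z\<close>.\<close>

lemma disc_coding:
  assumes X: "subshift A X" and Z: "finite Z" "Z \<noteq> {}"
    and H: "\<And>n. norm n = 1 \<Longrightarrow> (\<And>z. z \<in> Z \<Longrightarrow> n \<bullet> to_plane z \<le> 0) \<Longrightarrow>
       icodes X ({w. \<exists>z\<in>Z. n \<bullet> to_plane w < n \<bullet> to_plane z} \<union> Z) {0}"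
  shows "\<forall>\<^sub>F r in at_top. icodes X (\<Union>z\<in>Z. (+) z ` disc r) (disc r)"
proof (rule ccontr)
  assume "\<not> (\<forall>\<^sub>F r in at_top. icodes X (\<Union>z\<in>Z. (+) z ` disc r) (disc r))"
  then have "\<forall>k::nat. \<exists>r\<ge>real k. \<not> icodes X (\<Union>z\<in>Z. (+) z ` disc r) (disc r)"
    unfolding eventually_at_top_linorder by meson
  then obtain r where r: "\<And>k. r k \<ge> real k"
      "\<And>k. \<not> icodes X (\<Union>z\<in>Z. (+) z ` disc (r k)) (disc (r k))"
    by metis
  then have "\<forall>k. \<exists>x x' u. x \<in> X \<and> x' \<in> X \<and> (\<forall>w\<in>(\<Union>z\<in>Z. (+) z ` disc (r k)). x w = x' w) \<and>
      u \<in> disc (r k) \<and> x u \<noteq> x' u"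
    unfolding icodes_def by meson
  then obtain x x' u where xx: "\<And>k. x k \<in> X" "\<And>k. x' k \<in> X"
      "\<And>k w. w \<in> (\<Union>z\<in>Z. (+) z ` disc (r k)) \<Longrightarrow> x k w = x' k w"
      "\<And>k. u k \<in> disc (r k)" "\<And>k. x k (u k) \<noteq> x' k (u k)"
    by metis
  define U where "U k = to_plane (u k)" for k
  have in_un: "w \<in> (\<Union>z\<in>Z. (+) z ` disc (r k)) \<longleftrightarrow> (\<exists>z\<in>Z. norm (to_plane w - to_plane z) \<le> r k)" for w k
    by (simp add: in_translated_disc)
  have Ur: "norm (U k) \<le> r k" for k using xx(4)[of k] by (simp add: disc_def U_def)
  \<comment> \<open>An uncoded point lies in the disc about the origin and in none of the others, so
    it is nearer to the origin than to any centre.\<close>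
  have far: "norm (U k - to_plane z) > r k" if "z \<in> Z" for k z
  proof (rule ccontr)
    assume "\<not> norm (U k - to_plane z) > r k"
    then have "u k \<in> (\<Union>z\<in>Z. (+) z ` disc (r k))" unfolding in_un U_def using that by (meson not_less)
    with xx(3) xx(5) show False by metis
  qed
  obtain z0 where z0: "z0 \<in> Z" using Z by blast
  have Ubig: "norm (U k) > real k - norm (to_plane z0)" for k
    using far[OF z0, of k] r(1)[of k] norm_triangle_ineq4[of "U k" "to_plane z0"] by linarith
  have Uinf: "filterlim (\<lambda>k. norm (U k)) at_top sequentially"
  proof (rule filterlim_at_top_mono)
    show "filterlim (\<lambda>k. - norm (to_plane z0) + real k) at_top sequentially"
      using filterlim_tendsto_add_at_top[OF tendsto_const filterlim_real_sequentially] .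
    show "\<forall>\<^sub>F k in sequentially. - norm (to_plane z0) + real k \<le> norm (U k)"
      using Ubig by (intro always_eventually allI) (smt (verit, best))
  qed
  have "\<forall>k. sgn (U k) \<in> cball 0 1" by (simp add: norm_sgn)
  then obtain n s where s: "strict_mono (s :: nat \<Rightarrow> nat)" and "((\<lambda>k. sgn (U k)) \<circ> s) \<longlonglongrightarrow> n"
    by (rule seq_compactE[OF compact_imp_seq_compact[OF compact_cball]])
  then have lim: "(\<lambda>k. sgn (U (s k))) \<longlonglongrightarrow> n" by (simp add: o_def)
  have Usinf: "filterlim (\<lambda>k. norm (U (s k))) at_top sequentially"
    using filterlim_compose[OF Uinf filterlim_subseq[OF s]] .
  then have Upos: "\<forall>\<^sub>F k in sequentially. norm (U (s k)) > 0"
    unfolding filterlim_at_top_dense by blast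
  have "(\<lambda>k. norm (sgn (U (s k)))) \<longlonglongrightarrow> norm n" using lim by (rule tendsto_norm)
  moreover have "\<forall>\<^sub>F k in sequentially. norm (sgn (U (s k))) = 1"
    using Upos by eventually_elim (simp add: norm_sgn)
  then have "(\<lambda>k. norm (sgn (U (s k)))) \<longlonglongrightarrow> 1" by (rule tendsto_eventually)
  ultimately have n1: "norm n = 1" by (rule LIMSEQ_unique)
  have dir: "U k = norm (U k) *\<^sub>R sgn (U k)" for k
    by (cases "U k = 0") (simp_all add: sgn_div_norm)
  \<comment> \<open>Squaring \<open>norm U < norm (U - z)\<close> leaves twice the inner product of
    \<open>U\<close> and \<open>z\<close> below a constant, which vanishes in the limit after
    division by \<open>norm U\<close>.\<close>
  have polar: "n \<bullet> to_plane z \<le> 0" if "z \<in> Z" for z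
  proof (rule LIMSEQ_le)
    show "(\<lambda>k. sgn (U (s k)) \<bullet> to_plane z) \<longlonglongrightarrow> n \<bullet> to_plane z"
      by (intro tendsto_intros lim)
    show "(\<lambda>k. (norm (to_plane z))\<^sup>2 / 2 / norm (U (s k))) \<longlonglongrightarrow> 0"
      by (rule real_tendsto_divide_at_top[OF tendsto_const Usinf])
    have "\<forall>\<^sub>F k in sequentially. sgn (U (s k)) \<bullet> to_plane z \<le> (norm (to_plane z))\<^sup>2 / 2 / norm (U (s k))"
      using Upos
    proof eventually_elim
      case (elim k)
      let ?U = "U (s k)"
      have "(norm ?U)\<^sup>2 < (norm (?U - to_plane z))\<^sup>2"
        using far[OF that, of "s k"] Ur[of "s k"] by (intro power_strict_mono) auto
      then have "2 * (?U \<bullet> to_plane z) < (norm (to_plane z))\<^sup>2"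
        by (simp add: power2_norm_eq_inner inner_diff_left inner_diff_right inner_commute)
      moreover have "?U \<bullet> to_plane z = norm ?U * (sgn ?U \<bullet> to_plane z)"
        by (subst dir) simp
      ultimately show ?case using elim by (simp add: field_simps)
    qed
    then show "\<exists>N. \<forall>k\<ge>N. sgn (U (s k)) \<bullet> to_plane z \<le> (norm (to_plane z))\<^sup>2 / 2 / norm (U (s k))"
      by (simp add: eventually_sequentially)
  qed
  \<comment> \<open>Only the finitely many points of \<open>T\<close> have to be caught around
    \<open>u (s k)\<close>, so a single large \<open>k\<close> will do for all of them.\<close>
  obtain T where T: "T \<subseteq> {w. \<exists>z\<in>Z. n \<bullet> to_plane w < n \<bullet> to_plane z} \<union> Z" "finite T" "icodes X T {0}"
    using finite_coding_set[OF X H[OF n1 polar]] by blast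
  have "\<forall>\<^sub>F k in sequentially. u (s k) + w \<in> (\<Union>z\<in>Z. (+) z ` disc (r (s k)))" if "w \<in> T" for w
  proof (cases "w \<in> Z")
    \<comment> \<open>The point \<open>u + w\<close> is at distance \<open>norm u \<le> r\<close>
      from the centre \<open>w\<close>; this is how points on the boundary of the limit half plane
      are reached.\<close>
    case True
    then show ?thesis
      unfolding in_un using Ur by (intro always_eventually allI bexI[of _ w]) (auto simp: U_def)
  next
    case False
    then obtain z where z: "z \<in> Z" "n \<bullet> to_plane w < n \<bullet> to_plane z" using T \<open>w \<in> T\<close> by blast
    \<comment> \<open>Relative to the centre \<open>z\<close> the point sits at
      \<open>U + q\<close>. The inner product of \<open>U\<close> and \<open>q\<close> tends to
      minus infinity and outweighs the constant square of \<open>norm q\<close>, so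
      \<open>U + q\<close> is no longer than \<open>U\<close>.\<close>
    define q where "q = to_plane w - to_plane z"
    have nq: "n \<bullet> q < 0" using z by (simp add: q_def inner_diff_right)
    have "(\<lambda>k. sgn (U (s k)) \<bullet> q) \<longlonglongrightarrow> n \<bullet> q" by (intro tendsto_intros lim)
    then have ev1: "\<forall>\<^sub>F k in sequentially. sgn (U (s k)) \<bullet> q < (n \<bullet> q) / 2"
      by (rule order_tendstoD) (use nq in simp)
    have ev2: "\<forall>\<^sub>F k in sequentially. norm (U (s k)) > (norm q)\<^sup>2 / (- (n \<bullet> q))"
      using Usinf by (simp add: filterlim_at_top_dense)
    show ?thesis using ev1 ev2 Upos
    proof eventually_elim
      case (elim k)
      let ?U = "U (s k)"
      have "?U \<bullet> q = norm ?U * (sgn ?U \<bullet> q)" by (subst dir) simp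
      also have "\<dots> \<le> norm ?U * ((n \<bullet> q) / 2)" using elim by (intro mult_left_mono) auto
      finally have "2 * (?U \<bullet> q) \<le> norm ?U * (n \<bullet> q)" by simp
      moreover have "(norm q)\<^sup>2 < - (norm ?U * (n \<bullet> q))"
        using elim(2) nq by (simp add: field_simps)
      ultimately have "2 * (?U \<bullet> q) + (norm q)\<^sup>2 \<le> 0" by linarith
      then have "(norm (?U + q))\<^sup>2 \<le> (norm ?U)\<^sup>2"
        by (simp add: power2_norm_eq_inner inner_add_left inner_add_right inner_commute)
      then have "norm (?U + q) \<le> r (s k)"
        using Ur[of "s k"] by (meson norm_ge_zero order_trans power2_le_imp_le)
      then show ?case unfolding in_un using z by (auto simp: U_def q_def algebra_simps intro!: bexI[of _ z])
    qed
  qed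
  then have "\<forall>\<^sub>F k in sequentially. \<forall>w\<in>T. u (s k) + w \<in> (\<Union>z\<in>Z. (+) z ` disc (r (s k)))"
    using T(2) by (simp add: eventually_ball_finite_distrib)
  then obtain k where k: "\<And>w. w \<in> T \<Longrightarrow> u (s k) + w \<in> (\<Union>z\<in>Z. (+) z ` disc (r (s k)))"
    unfolding eventually_sequentially by blast
  have "x (s k) (u (s k) + 0) = x' (s k) (u (s k) + 0)"
  proof (rule icodesD[OF icodes_translate[OF X T(3), of "u (s k)"] xx(1,2)])
    fix v assume "v \<in> (+) (u (s k)) ` T"
    then show "x (s k) v = x' (s k) v" using k xx(3) by (metis (no_types) imageE)
  qed simp
  with xx(5)[of "s k"] show False by simp
qed

section \<open>Nonexpansive directions\<close>

definition icross :: "int \<times> int \<Rightarrow> int \<times> int \<Rightarrow> int" where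
  "icross v w = fst v * snd w - snd v * fst w"

definition zmul :: "int \<Rightarrow> int \<times> int \<Rightarrow> int \<times> int" where
  "zmul k v = (k * fst v, k * snd v)"

lemma icross_simps [simp]:
  "icross v 0 = 0" "icross 0 v = 0" "icross v v = 0"
  "icross v (u + w) = icross v u + icross v w"
  "icross v (u - w) = icross v u - icross v w"
  "icross (u + w) v = icross u v + icross w v"
  "icross v (- u) = - icross v u" "icross (- u) v = - icross u v"
  "icross v (zmul k u) = k * icross v u" "icross (zmul k u) v = k * icross u v"
  by (simp_all add: icross_def zmul_def algebra_simps)

lemma icross_swap: "icross v w = - icross w v"
  by (simp add: icross_def)

lemma to_plane_zmul [simp]: "to_plane (zmul k v) = of_int k *\<^sub>R to_plane v"
  by (simp add: zmul_def to_plane_def)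

lemma zmul_simps [simp]: "zmul 1 v = v" "zmul (-1) v = - v" "zmul 0 v = 0" "zmul k 0 = 0"
  "zmul k (- v) = - zmul k v" "zmul (- k) v = - zmul k v"
  by (simp_all add: zmul_def prod_eq_iff)

lemma cross2_simps [simp]:
  "cross2 v 0 = 0" "cross2 0 v = 0" "cross2 v v = 0"
  "cross2 v (u + w) = cross2 v u + cross2 v w"
  "cross2 v (u - w) = cross2 v u - cross2 v w"
  "cross2 v (- u) = - cross2 v u" "cross2 (- u) v = - cross2 u v"
  "cross2 v (c *\<^sub>R u) = c * cross2 v u" "cross2 (c *\<^sub>R u) v = c * cross2 u v"
  by (simp_all add: cross2_def algebra_simps)

lemma cross2_to_plane [simp]: "cross2 (to_plane v) (to_plane w) = of_int (icross v w)"
  by (simp add: cross2_def icross_def to_plane_def)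

lemma cross2_eq_inner: "cross2 v w = (- snd v, fst v) \<bullet> w"
  by (simp add: cross2_def inner_prod_def algebra_simps)

lemma cross2_le_norm: "\<bar>cross2 v w\<bar> \<le> norm v * norm w"
proof -
  have "norm (- snd v, fst v) = norm v" by (simp add: norm_prod_def add.commute)
  then show ?thesis unfolding cross2_eq_inner by (metis Cauchy_Schwarz_ineq2)
qed

lemma parallel_if_cross2_zero:
  assumes "v \<noteq> 0" "cross2 v w = 0"
  obtains t where "w = t *\<^sub>R v"
proof (cases "fst v = 0")
  case True
  then have "snd v \<noteq> 0" using assms by (metis prod.expand zero_prod_def fst_conv snd_conv)
  then have "w = (snd w / snd v) *\<^sub>R v" using assms True by (auto simp: cross2_def prod_eq_iff)
  then show ?thesis by (rule that)
next
  case False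
  then have "w = (fst w / fst v) *\<^sub>R v" using assms by (auto simp: cross2_def prod_eq_iff field_simps)
  then show ?thesis by (rule that)
qed

lemma left_halfplane_scaleR: "c > 0 \<Longrightarrow> left_halfplane p (c *\<^sub>R v) = left_halfplane p v"
  by (simp add: left_halfplane_def zero_le_mult_iff del: cross2_simps(5))

lemma lattice_cross2_unbounded:
  assumes "v \<noteq> 0"
  obtains u where "cross2 v (to_plane u) > c"
proof (cases "fst v = 0")
  case True
  then have v: "snd v \<noteq> 0" using assms by (metis prod.expand zero_prod_def fst_conv snd_conv)
  obtain k :: nat where k: "real k * \<bar>snd v\<bar> > c"
    using reals_Archimedean3[of "\<bar>snd v\<bar>"] v by auto
  have "cross2 v (to_plane (if snd v > 0 then - int k else int k, 0)) = real k * \<bar>snd v\<bar>"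
    by (simp add: cross2_def to_plane_def)
  with k show ?thesis using that by metis
next
  case False
  obtain k :: nat where k: "real k * \<bar>fst v\<bar> > c"
    using reals_Archimedean3[of "\<bar>fst v\<bar>"] False by auto
  have "cross2 v (to_plane (0, if fst v > 0 then int k else - int k)) = real k * \<bar>fst v\<bar>"
    by (simp add: cross2_def to_plane_def)
  with k show ?thesis using that by metis
qed

text \<open>Only the direction of the half plane matters: a lattice translation carries it beyond
  any threshold \<open>c\<close>, and \<open>S\<close> contains everything there.\<close>

lemma expansive_icodes:
  assumes X: "subshift A X" and "v \<noteq> 0" and E: "expansive X (left_halfplane p v)"
    and S: "\<And>w. cross2 v (to_plane w) > c \<Longrightarrow> w \<in> S"
  shows "icodes X S T"
proof -
  obtain u where u: "cross2 v (to_plane u) > c - cross2 v p"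
    using lattice_cross2_unbounded[OF \<open>v \<noteq> 0\<close>] .
  have "icodes X ((+) u ` (to_plane -` left_halfplane p v)) ((+) u ` (to_plane -` UNIV))"
    using E icodes_translate[OF X] unfolding expansive_def codes_eq_icodes by blast
  then show ?thesis
  proof (rule icodes_mono)
    show "(+) u ` (to_plane -` left_halfplane p v) \<subseteq> S"
      using u by (auto simp: left_halfplane_def intro!: S)
    show "T \<subseteq> (+) u ` (to_plane -` UNIV)"
      by (metis (no_types) surj_plus UNIV_I subsetI vimage_UNIV)
  qed
qed

lemma expansive_left_halfplane_iff:
  assumes X: "subshift A X" and "v \<noteq> 0"
  shows "expansive X (left_halfplane p v) \<longleftrightarrow> expansive X (left_halfplane q v)"
proof -
  have "expansive X (left_halfplane q v)" if "expansive X (left_halfplane p v)" for p q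
    unfolding expansive_def[of _ "left_halfplane q v"] codes_eq_icodes
    by (rule expansive_icodes[OF assms that, of "cross2 v q"]) (simp add: left_halfplane_def)
  then show ?thesis by blast
qed

section \<open>Rays and their primitive integer directions\<close>

lemma ray_scaleR: "c > 0 \<Longrightarrow> ray p (c *\<^sub>R v) = ray p v"
proof -
  assume c: "c > 0"
  have "\<exists>s. p + t *\<^sub>R c *\<^sub>R v = p + s *\<^sub>R v \<and> 0 \<le> s" if "0 \<le> t" for t
    using that c by (intro exI[of _ "t * c"]) auto
  moreover have "\<exists>s. p + t *\<^sub>R v = p + s *\<^sub>R c *\<^sub>R v \<and> 0 \<le> s" if "0 \<le> t" for t
    using that c by (intro exI[of _ "t / c"]) auto
  ultimately show ?thesis unfolding ray_def by blast
qed

lemma ray_eq_ray: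
  assumes "ray p v = ray p' v'" "v \<noteq> 0" "v' \<noteq> 0"
  shows "p = p' \<and> (\<exists>c>0. v' = c *\<^sub>R v)"
proof -
  have "p' + 0 *\<^sub>R v' \<in> ray p' v'" "p' + 1 *\<^sub>R v' \<in> ray p' v'"
    unfolding ray_def using zero_le_one by blast+
  then have "p' \<in> ray p v" "p' + v' \<in> ray p v" unfolding assms(1) by simp_all
  then obtain t s where t: "p' = p + t *\<^sub>R v" "t \<ge> 0" and s: "p' + v' = p + s *\<^sub>R v" "s \<ge> 0"
    unfolding ray_def by blast
  define c where "c = s - t"
  have v': "v' = c *\<^sub>R v" using s t by (simp add: c_def algebra_simps)
  then have c0: "c \<noteq> 0" using assms by auto
  \<comment> \<open>Each \<open>p + K v\<close> with \<open>K \<ge> 0\<close> lies on the second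
    ray; \<open>K = t + 1\<close> will force \<open>c > 0\<close>, and then \<open>K = 0\<close>
    forces \<open>t = 0\<close>.\<close>
  have key: "\<exists>r\<ge>0. K = t + r * c" if "K \<ge> 0" for K
  proof -
    have "p + K *\<^sub>R v \<in> ray p v" unfolding ray_def using that by blast
    then have "p + K *\<^sub>R v \<in> ray p' v'" unfolding assms(1) .
    then obtain r where r: "p + K *\<^sub>R v = p' + r *\<^sub>R v'" "r \<ge> 0" unfolding ray_def by blast
    then have "K *\<^sub>R v = (t + r * c) *\<^sub>R v" using t v' by (simp add: algebra_simps)
    then show ?thesis using assms(2) r(2) by (metis scaleR_right_imp_eq)
  qed
  have "c > 0"
  proof (rule ccontr)
    assume "\<not> c > 0"
    obtain r where "r \<ge> 0" "t + 1 = t + r * c" using key[of "t + 1"] t by auto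
    with \<open>\<not> c > 0\<close> show False by (simp add: mult_nonneg_nonpos not_less) (metis mult_nonneg_nonpos not_one_le_zero)
  qed
  moreover have "t = 0"
  proof -
    obtain r where "r \<ge> 0" "0 = t + r * c" using key[of 0] by auto
    then show ?thesis using \<open>c > 0\<close> t by (metis add_nonneg_eq_0_iff less_eq_real_def mult_nonneg_nonneg)
  qed
  ultimately show ?thesis using t v' by auto
qed

lemma primitive_direction:
  assumes "v \<noteq> 0" "fst v = 0 \<or> snd v / fst v \<in> \<rat>"
  obtains a c where "coprime (fst a) (snd a)" "c > 0" "v = c *\<^sub>R to_plane a"
proof (cases "fst v = 0")
  case True
  then have "snd v \<noteq> 0" using assms by (metis prod.expand zero_prod_def fst_conv snd_conv)
  then have "v = \<bar>snd v\<bar> *\<^sub>R to_plane (0, if snd v > 0 then 1 else -1)" using True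
    by (auto simp: to_plane_def prod_eq_iff)
  then show ?thesis using that[of "(0, if snd v > 0 then 1 else -1)" "\<bar>snd v\<bar>"] \<open>snd v \<noteq> 0\<close> by auto
next
  case False
  then obtain m n :: int where mn: "n > 0" "coprime m n" "snd v / fst v = of_int m / of_int n"
    using assms Rats_cases' by blast
  have sv: "snd v * of_int n = of_int m * fst v" using mn(1,3) False by (simp add: field_simps)
  \<comment> \<open>The sign goes into the integer vector, so that the factor is positive and the
    orientation is kept.\<close>
  let ?e = "if fst v > 0 then 1 else -1 :: int"
  have "v = (\<bar>fst v\<bar> / of_int n) *\<^sub>R to_plane (?e * n, ?e * m)"
    using mn(1) sv False by (auto simp: to_plane_def prod_eq_iff field_simps)
  moreover have "coprime (?e * n) (?e * m)" using mn(2) by (auto simp: coprime_commute)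
  ultimately show ?thesis using that[of "(?e * n, ?e * m)" "\<bar>fst v\<bar> / of_int n"] mn(1) False by auto
qed

lemma to_plane_nonzero: "coprime (fst v) (snd v) \<Longrightarrow> to_plane v \<noteq> 0"
  by (auto simp: to_plane_def prod_eq_iff)

text \<open>The integer functional given by the Bezout coefficients takes the value \<open>1\<close>
  at \<open>v\<close>; evaluated at \<open>w\<close> it returns \<open>s\<close>, which is therefore
  an integer.\<close>

lemma primitive_multiple:
  assumes "coprime (fst v) (snd v)" "to_plane w = s *\<^sub>R to_plane v"
  obtains k where "s = of_int k" "w = zmul k v"
proof -
  obtain a b where ab: "a * fst v + b * snd v = 1"
    using assms(1) by (metis bezout_int coprime_imp_gcd_eq_1)
  define k where "k = a * fst w + b * snd w"
  have "fst (to_plane w) = s * fst (to_plane v)" "snd (to_plane w) = s * snd (to_plane v)"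
    using assms(2) by simp_all
  then have "real_of_int k = s * of_int (a * fst v + b * snd v)"
    by (simp add: k_def to_plane_def algebra_simps)
  then have s: "s = of_int k" using ab by simp
  then have "to_plane w = to_plane (zmul k v)" using assms(2) by simp
  with s that show ?thesis unfolding to_plane_inject by blast
qed

lemma primitive_parallel:
  assumes "coprime (fst v) (snd v)" "coprime (fst w) (snd w)" "icross v w = 0"
  shows "w = v \<or> w = - v"
proof -
  have "cross2 (to_plane v) (to_plane w) = 0" using assms(3) by simp
  then obtain t where "to_plane w = t *\<^sub>R to_plane v"
    using parallel_if_cross2_zero to_plane_nonzero[OF assms(1)] by blast
  then obtain k where k: "w = zmul k v" using primitive_multiple[OF assms(1)] by blast
  then have "k dvd fst w" "k dvd snd w" by (auto simp: zmul_def)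
  then have "\<bar>k\<bar> = 1" using assms(2) by (meson coprime_common_divisor zdvd1_eq)
  then show ?thesis using k by (auto simp: abs_if split: if_splits)
qed

text \<open>A primitive integer vector is the canonical name of a rational ray up to translation, so
  that parallelism becomes an equation between integers.\<close>

definition nonexp :: "'a config set \<Rightarrow> (int \<times> int) set" where
  "nonexp X = {v. coprime (fst v) (snd v) \<and> \<not> expansive X (left_halfplane 0 (to_plane v))}"

lemma nonexp_ray: "v \<in> nonexp X \<Longrightarrow> ray 0 (to_plane v) \<in> nonexpansive_rays X"
  unfolding nonexp_def nonexpansive_rays_def using to_plane_nonzero by blast

lemma nonexp_direction:
  assumes X: "subshift A X" and R: "\<forall>l\<in>nonexpansive_rays X. rational_ray l"
    and d: "d \<noteq> 0" "\<not> expansive X (left_halfplane p d)"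
  obtains v c where "v \<in> nonexp X" "c > 0" "d = c *\<^sub>R to_plane v"
proof -
  have "ray p d \<in> nonexpansive_rays X" unfolding nonexpansive_rays_def using d by blast
  then have "rational_ray (ray p d)" using R by blast
  then obtain q e where e: "e \<noteq> 0" "ray p d = ray q e" "fst e = 0 \<or> snd e / fst e \<in> \<rat>"
    unfolding rational_ray_def by blast
  then obtain c where c: "c > 0" "e = c *\<^sub>R d" using ray_eq_ray d(1) by blast
  obtain a b where a: "coprime (fst a) (snd a)" "b > 0" "e = b *\<^sub>R to_plane a"
    using primitive_direction[OF e(1,3)] .
  have "d = (1 / c) *\<^sub>R e" using c by simp
  then have dd: "d = (b / c) *\<^sub>R to_plane a" using a(3) by simp
  have "\<not> expansive X (left_halfplane p (to_plane a))"
    using d(2) left_halfplane_scaleR[of "b / c" p "to_plane a"] a(2) c(1) dd by simp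
  then have "a \<in> nonexp X"
    using expansive_left_halfplane_iff[OF X to_plane_nonzero[OF a(1)]] a(1) unfolding nonexp_def by blast
  then show ?thesis using that[of a "b / c"] dd a(2) c(1) by simp
qed

lemma nonexpansive_ray_direction:
  assumes X: "subshift A X" and R: "\<forall>l\<in>nonexpansive_rays X. rational_ray l"
    and "l \<in> nonexpansive_rays X"
  obtains v p where "v \<in> nonexp X" "l = ray p (to_plane v)"
proof -
  obtain p d where d: "d \<noteq> 0" "l = ray p d" "\<not> expansive X (left_halfplane p d)"
    using assms(3) unfolding nonexpansive_rays_def by blast
  from nonexp_direction[OF X R d(1,3)] show ?thesis
    using d(2) ray_scaleR that by metis
qed

text \<open>Primitive vectors whose rays are translates of each other are positively parallel, hence
  equal; so distinct members have distinct translation classes.\<close>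

lemma finite_nonexp:
  assumes "finite (nonexpansive_rays X // translation_rel)"
  shows "finite (nonexp X)"
proof (rule inj_on_finite[OF _ _ assms])
  show "inj_on (\<lambda>v. translation_rel `` {ray 0 (to_plane v)}) (nonexp X)"
  proof (rule inj_onI)
    fix v w assume v: "v \<in> nonexp X" and w: "w \<in> nonexp X"
      and eq: "translation_rel `` {ray 0 (to_plane v)} = translation_rel `` {ray 0 (to_plane w)}"
    have "ray 0 (to_plane v) \<in> translation_rel `` {ray 0 (to_plane v)}"
    proof -
      have "ray 0 (to_plane v) = (\<lambda>p. 0 + p) ` ray 0 (to_plane v)" by simp
      then show ?thesis unfolding translation_rel_def by blast
    qed
    then have "(ray 0 (to_plane w), ray 0 (to_plane v)) \<in> translation_rel"
      unfolding eq Image_singleton_iff .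
    then obtain q where "ray 0 (to_plane v) = (\<lambda>p. q + p) ` ray 0 (to_plane w)"
      unfolding translation_rel_def mem_Collect_eq prod.case by blast
    also have "\<dots> = ray q (to_plane w)" by (auto simp: ray_def)
    finally obtain c where c: "c > 0" "to_plane w = c *\<^sub>R to_plane v"
      using ray_eq_ray to_plane_nonzero v w unfolding nonexp_def by blast
    have cv: "coprime (fst v) (snd v)" and cw: "coprime (fst w) (snd w)"
      using v w by (auto simp: nonexp_def)
    have "cross2 (to_plane v) (to_plane w) = 0" using c by simp
    then have "w = v \<or> w = - v" using primitive_parallel[OF cv cw] by simp
    moreover have "w \<noteq> - v"
    proof
      assume "w = - v"
      then have "c *\<^sub>R to_plane v = - to_plane v" using c(2) by simp
      then have "(c + 1) *\<^sub>R to_plane v = 0" by (simp add: scaleR_left_distrib)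
      then show False using c(1) to_plane_nonzero[OF cv] by simp
    qed
    ultimately show "v = w" by simp
  qed
  show "(\<lambda>v. translation_rel `` {ray 0 (to_plane v)}) ` nonexp X \<subseteq> nonexpansive_rays X // translation_rel"
    using nonexp_ray by (auto intro: quotientI)
qed

text \<open>The closing condition, translated so that the line next to the half plane passes through the
  origin; \<open>\<sigma>\<close> selects the side of the origin on which the block lies.\<close>

lemma closing_icodes:
  assumes X: "subshift A X" and v: "coprime (fst v) (snd v)"
    and C: "closing_ray X (ray 0 (to_plane v))"
  obtains N :: nat where
    "\<And>\<sigma> K. \<sigma> = 1 \<or> \<sigma> = -1 \<Longrightarrow> (\<And>t. 1 \<le> t \<Longrightarrow> t \<le> int N \<Longrightarrow> zmul (\<sigma> * t) v \<in> K) \<Longrightarrow>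
        icodes X ({w. icross v w > 0} \<union> K) {0}"
proof -
  let ?v = "to_plane v"
  let ?H = "left_halfplane 0 ?v" and ?L = "span {?v}"
  have v0: "?v \<noteq> 0" using to_plane_nonzero[OF v] .
  obtain p d where d: "d \<noteq> 0" "ray 0 ?v = ray p d" "closing_halfplane X (span {d}) (left_halfplane 0 d)"
    using C unfolding closing_ray_def by blast
  obtain c where c: "c > 0" "d = c *\<^sub>R ?v" using ray_eq_ray[OF d(2) v0 d(1)] by blast
  have "span {d} = ?L" unfolding c(2)
    using span_image_scale[of "{?v}" "\<lambda>_. c"] c(1) by simp
  with d(3) c have "closing_halfplane X ?L ?H" by (simp add: left_halfplane_scaleR)
  then obtain L0 N where L0: "next_line ?L ?H L0" and N: "(N::nat) > 0"
    and clo: "\<And>K. block L0 K \<Longrightarrow> card K \<ge> N \<Longrightarrow> codes X (?H \<union> K) (?H \<union> L0)"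
    unfolding closing_halfplane_def by blast
  have span: "?L = {t *\<^sub>R ?v | t. True}" by (auto simp: span_singleton)
  have L0_line: "\<exists>z\<in>lattice. L0 = (\<lambda>p. z + p) ` ?L" and L0_H: "L0 \<inter> ?H = {}"
    and minimal: "\<forall>M. (\<exists>z\<in>lattice. M = (\<lambda>p. z + p) ` ?L) \<and> M \<inter> ?H = {} \<longrightarrow> setdist ?L L0 \<le> setdist ?L M"
    using L0 unfolding next_line_def Let_def Ball_def mem_Collect_eq by (blast, blast, meson)
  obtain z where z: "L0 = (\<lambda>p. to_plane z + p) ` ?L" "L0 \<inter> ?H = {}"
    using L0_line L0_H by (metis rangeE)
  have zmin: "setdist ?L L0 \<le> setdist ?L ((\<lambda>p. to_plane y + p) ` ?L)"
    if "((\<lambda>p. to_plane y + p) ` ?L) \<inter> ?H = {}" for y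
    by (rule minimal[rule_format]) (use that in blast)
  have L0_cross: "cross2 ?v q = of_int (icross v z)" if "q \<in> L0" for q
    using that unfolding z(1) span by auto
  have z_in: "to_plane z \<in> L0" unfolding z(1) using span_0 by force
  then have neg: "icross v z < 0" using z(2) L0_cross[OF z_in] by (force simp: left_halfplane_def)
  \<comment> \<open>The lattice lines along \<open>v\<close> are levels of the integer-valued
    \<open>icross v\<close>, and level \<open>k\<close> is at distance
    \<open>\<bar>k\<bar> / norm v\<close> from level \<open>0\<close>; since level \<open>-1\<close>
    is attained, the closest line outside the half plane is that one.\<close>
  have cz: "icross v z = -1"
  proof -
    obtain a b where ab: "a * fst v + b * snd v = 1"
      using v by (metis bezout_int coprime_imp_gcd_eq_1)
    define y where "y = (b, - a)"
    have y: "icross v y = -1" using ab by (simp add: y_def icross_def algebra_simps)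
    define M where "M = (\<lambda>p. to_plane y + p) ` ?L"
    have "M \<inter> ?H = {}" using y unfolding M_def span by (auto simp: left_halfplane_def)
    then have "setdist ?L L0 \<le> setdist ?L M" using zmin unfolding M_def by blast
    moreover have "- of_int (icross v z) / norm ?v \<le> setdist ?L L0"
    proof (rule le_setdistI)
      fix q r assume q: "q \<in> ?L" and r: "r \<in> L0"
      have "cross2 ?v (r - q) = of_int (icross v z)"
        using q L0_cross[OF r] unfolding span by auto
      then have "- of_int (icross v z) \<le> norm ?v * norm (r - q)"
        using cross2_le_norm[of ?v "r - q"] neg by linarith
      then show "- of_int (icross v z) / norm ?v \<le> dist q r"
        unfolding dist_norm norm_minus_commute[of q r]
        by (intro mult_imp_div_pos_le) (use v0 in \<open>simp_all add: mult.commute\<close>)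
    qed (use z_in span_0 in blast)+
    moreover have "setdist ?L M \<le> 1 / norm ?v"
    proof -
      \<comment> \<open>The foot of the perpendicular from the origin to \<open>M\<close>.\<close>
      define r where "r = (1 / (norm ?v)\<^sup>2) *\<^sub>R (snd ?v, - fst ?v)"
      have n2: "(norm ?v)\<^sup>2 = (fst ?v)\<^sup>2 + (snd ?v)\<^sup>2" by (simp add: norm_prod_def)
      have "cross2 ?v r = (1 / (norm ?v)\<^sup>2) * cross2 ?v (snd ?v, - fst ?v)"
        by (simp only: r_def cross2_simps)
      also have "cross2 ?v (snd ?v, - fst ?v) = - (norm ?v)\<^sup>2"
        unfolding n2 by (simp add: cross2_def power2_eq_square)
      finally have "cross2 ?v r = -1" using v0 by simp
      then have "cross2 ?v (r - to_plane y) = 0" using y by simp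
      then obtain t where "r - to_plane y = t *\<^sub>R ?v" using parallel_if_cross2_zero[OF v0] by blast
      then have "r = to_plane y + t *\<^sub>R ?v" by (simp add: algebra_simps)
      then have "r \<in> M" unfolding M_def span by blast
      then have "setdist ?L M \<le> dist 0 r" by (rule setdist_le_dist[OF span_0])
      also have "\<dots> = norm (snd ?v, - fst ?v) / (norm ?v)\<^sup>2"
        unfolding r_def dist_0_norm norm_scaleR by simp
      also have "norm (snd ?v, - fst ?v) = norm ?v" by (simp add: norm_prod_def add.commute)
      finally show ?thesis using v0 by (simp add: power2_eq_square)
    qed
    ultimately have "- of_int (icross v z) / norm ?v \<le> 1 / norm ?v" by linarith
    then have "- real_of_int (icross v z) \<le> 1" using v0 unfolding divide_le_cancel by simp
    then show ?thesis using neg by linarith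
  qed
  show ?thesis
  proof (rule that[of N])
    fix \<sigma> :: int and K assume \<sigma>: "\<sigma> = 1 \<or> \<sigma> = -1"
      and K: "\<And>t. 1 \<le> t \<Longrightarrow> t \<le> int N \<Longrightarrow> zmul (\<sigma> * t) v \<in> K"
    \<comment> \<open>The block runs from \<open>t = 1\<close> to \<open>t = N\<close>, leaving out
      the point \<open>z\<close>, which is to be coded.\<close>
    define a b where "a = to_plane (z + zmul \<sigma> v)" and "b = to_plane (z + zmul (\<sigma> * int N) v)"
    define G where "G = lattice \<inter> closed_segment a b"
    have "a \<in> L0" "b \<in> L0" unfolding a_def b_def z(1) span by auto
    then have G: "block L0 G" unfolding block_def G_def by blast
    have seg: "z + zmul (\<sigma> * t) v \<in> to_plane -` closed_segment a b" if "1 \<le> t" "t \<le> int N" for t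
    proof (cases "N = 1")
      case True
      then show ?thesis using that by (simp add: a_def)
    next
      case False
      define s where "s = (real_of_int t - 1) / (real N - 1)"
      have N1: "real N - 1 > 0" using N False by simp
      then have "s * (real N - 1) = real_of_int t - 1" by (simp add: s_def)
      moreover have "0 \<le> s" "s \<le> 1" using that N1 by (simp_all add: s_def)
      ultimately have s: "0 \<le> s" "s \<le> 1" "real_of_int t = (1 - s) + s * real N"
        by (simp_all add: algebra_simps)
      have "to_plane (z + zmul (\<sigma> * t) v) = to_plane z + (of_int \<sigma> * ((1 - s) + s * real N)) *\<^sub>R ?v"
        unfolding s(3)[symmetric] by simp
      also have "\<dots> = (1 - s) *\<^sub>R a + s *\<^sub>R b"
        by (simp add: a_def b_def algebra_simps)
      finally have "to_plane (z + zmul (\<sigma> * t) v) = (1 - s) *\<^sub>R a + s *\<^sub>R b" .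
      then show ?thesis using s by (auto simp: in_segment)
    qed
    \<comment> \<open>The segment holds no further lattice points, because real multiples of a
      primitive vector are integral only for integer factors; so the block, once translated, stays
      inside \<open>K\<close>.\<close>
    have seg2: "\<exists>t. 1 \<le> t \<and> t \<le> int N \<and> w = z + zmul (\<sigma> * t) v" if w: "to_plane w \<in> closed_segment a b" for w
    proof -
      obtain s where s: "0 \<le> s" "s \<le> 1" "to_plane w = (1 - s) *\<^sub>R a + s *\<^sub>R b"
        using w by (auto simp: in_segment)
      define r where "r = (1 - s) + s * real N"
      have "r - 1 = s * (real N - 1)" "real N - r = (1 - s) * (real N - 1)" by (auto simp: r_def algebra_simps)
      then have r: "1 \<le> r" "r \<le> real N" using s N
        by (metis diff_ge_0_iff_ge mult_nonneg_nonneg of_nat_1 of_nat_le_iff One_nat_def Suc_leI)+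
      have "to_plane (w - z) = (of_int \<sigma> * r) *\<^sub>R ?v"
        unfolding to_plane_simps s(3) a_def b_def r_def to_plane_zmul
        by (simp add: algebra_simps)
      then obtain k where k: "of_int \<sigma> * r = of_int k" "w - z = zmul k v"
        using primitive_multiple[OF v] by blast
      have "r = of_int (\<sigma> * k)" using k(1) \<sigma> by auto
      moreover have "w = z + zmul (\<sigma> * (\<sigma> * k)) v" using k(2) \<sigma> by (auto simp: algebra_simps)
      ultimately show ?thesis using r by (intro exI[of _ "\<sigma> * k"]) linarith
    qed
    have "N \<le> card G"
    proof -
      have "inj_on (\<lambda>t. to_plane (z + zmul (\<sigma> * t) v)) {1..int N}"
      proof (rule inj_onI)
        fix x y assume "to_plane (z + zmul (\<sigma> * x) v) = to_plane (z + zmul (\<sigma> * y) v)"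
        then have "zmul (\<sigma> * x) v = zmul (\<sigma> * y) v" unfolding to_plane_inject by simp
        then have "\<sigma> * x * fst v = \<sigma> * y * fst v" "\<sigma> * x * snd v = \<sigma> * y * snd v"
          unfolding zmul_def by (auto dest: arg_cong[of _ _ fst] arg_cong[of _ _ snd])
        moreover have "fst v \<noteq> 0 \<or> snd v \<noteq> 0" using v by auto
        ultimately show "x = y" using \<sigma> by auto
      qed
      then have "card ((\<lambda>t. to_plane (z + zmul (\<sigma> * t) v)) ` {1..int N}) = N" by (simp add: card_image)
      moreover have "(\<lambda>t. to_plane (z + zmul (\<sigma> * t) v)) ` {1..int N} \<subseteq> G"
        using seg unfolding G_def by (force simp del: to_plane_simps)
      moreover have "finite G"
      proof -
        have "G = to_plane ` {u. to_plane u \<in> closed_segment a b}" unfolding G_def by auto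
        then show ?thesis using finite_lattice_bounded[OF bounded_closed_segment] by simp
      qed
      ultimately show ?thesis by (metis card_mono)
    qed
    then have "icodes X (to_plane -` (?H \<union> G)) (to_plane -` (?H \<union> L0))"
      using clo[OF G] unfolding codes_eq_icodes by blast
    \<comment> \<open>Moving \<open>z\<close> to the origin raises the level by one, so the closed
      half plane at level \<open>0\<close> lands in the open half plane
      \<open>icross v w > 0\<close>.\<close>
    then have "icodes X ((+) (- z) ` (to_plane -` (?H \<union> G))) ((+) (- z) ` (to_plane -` (?H \<union> L0)))"
      by (rule icodes_translate[OF X])
    then show "icodes X ({w. icross v w > 0} \<union> K) {0}"
    proof (rule icodes_mono)
      have "z \<in> to_plane -` (?H \<union> L0)" using z_in by simp
      then have "- z + z \<in> (+) (- z) ` (to_plane -` (?H \<union> L0))" by (rule imageI)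
      then show "{0} \<subseteq> (+) (- z) ` (to_plane -` (?H \<union> L0))" by simp
      show "(+) (- z) ` (to_plane -` (?H \<union> G)) \<subseteq> {w. icross v w > 0} \<union> K"
      proof
        fix w assume "w \<in> (+) (- z) ` (to_plane -` (?H \<union> G))"
        then obtain y where y: "w = - z + y" "to_plane y \<in> ?H \<or> to_plane y \<in> G" by auto
        from y(2) show "w \<in> {w. icross v w > 0} \<union> K"
        proof
          assume "to_plane y \<in> ?H"
          then have "icross v y \<ge> 0" by (simp add: left_halfplane_def)
          then show ?thesis using cz y(1) by simp
        next
          assume "to_plane y \<in> G"
          then obtain t where "1 \<le> t" "t \<le> int N" "y = z + zmul (\<sigma> * t) v"
            using seg2 unfolding G_def by blast
          then show ?thesis using K y(1) by simp
        qed
      qed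
    qed
  qed
qed

section \<open>The nonexpansive directions are not confined to a half plane\<close>

lemma shift_shift: "shift a (shift b x) = shift (a + b) x"
  by (simp add: shift_def fun_eq_iff algebra_simps)

lemma shift_0 [simp]: "shift 0 x = x"
  by (simp add: shift_def)

text \<open>Translation by \<open>w\<close> induces a surjection of the finite set of patterns on \<open>S\<close>, which is
  then injective.\<close>

lemma icodes_backward:
  assumes X: "subshift A X" and fin: "finite ((\<lambda>x. restrict x S) ` X)"
    and fwd: "icodes X S ((+) w ` S)"
  shows "icodes X ((+) w ` S) S"
proof -
  let ?R = "(\<lambda>x. restrict x S) ` X"
  \<comment> \<open>\<open>h\<close> sends a pattern to the one read after a shift by
    \<open>w\<close>; forward coding makes the result independent of the chosen extension.\<close>
  define h where "h r = restrict (shift w (SOME x. x \<in> X \<and> restrict x S = r)) S" for r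
  have h: "h (restrict x S) = restrict (shift w x) S" if "x \<in> X" for x
  proof -
    define y where "y = (SOME y. y \<in> X \<and> restrict y S = restrict x S)"
    have "y \<in> X \<and> restrict y S = restrict x S"
      unfolding y_def by (rule someI[of _ x]) (use that in simp)
    then have y: "y \<in> X" "\<And>s. s \<in> S \<Longrightarrow> y s = x s" by (auto simp: restrict_def fun_eq_iff split: if_splits)
    have "y (w + s) = x (w + s)" if "s \<in> S" for s
      by (rule icodesD[OF fwd y(1) \<open>x \<in> X\<close> y(2)]) (use that in auto)
    then show ?thesis unfolding h_def y_def[symmetric] by (auto simp: restrict_def shift_def)
  qed
  have "?R \<subseteq> h ` ?R"
  proof
    fix r assume "r \<in> ?R"
    then obtain x where x: "x \<in> X" "r = restrict x S" by blast
    have "shift (- w) x \<in> X" using shift_in[OF X x(1)] .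
    then have "h (restrict (shift (- w) x) S) = r" using h x by (simp add: shift_shift)
    then show "r \<in> h ` ?R" using \<open>shift (- w) x \<in> X\<close> by blast
  qed
  then have inj: "inj_on h ?R" by (rule finite_surj_inj[OF fin])
  show ?thesis
    unfolding icodes_def
  proof (intro ballI impI)
    fix x x' u assume x: "x \<in> X" "x' \<in> X" "\<forall>u\<in>(+) w ` S. x u = x' u" "u \<in> S"
    then have "restrict (shift w x) S = restrict (shift w x') S"
      by (auto simp: restrict_def shift_def)
    then have "restrict x S = restrict x' S"
      using inj h x(1,2) by (metis (no_types, lifting) image_eqI inj_onD)
    then show "x u = x' u" using x(4) by (metis restrict_apply')
  qed
qed

lemma icodes_iterate:
  assumes X: "subshift A X" and fwd: "icodes X S ((+) w ` S)"
    and x: "x \<in> X" "x' \<in> X" "\<And>s. s \<in> S \<Longrightarrow> x s = x' s" and "s \<in> S"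
  shows "shift (zmul (int j) w) x s = shift (zmul (int j) w) x' s"
  using \<open>s \<in> S\<close>
proof (induction j arbitrary: s)
  case 0
  then show ?case using x by simp
next
  case (Suc j)
  have "shift (zmul (int j) w) x (w + s) = shift (zmul (int j) w) x' (w + s)"
    by (rule icodesD[OF fwd shift_in[OF X x(1)] shift_in[OF X x(2)] Suc.IH]) (use Suc.prems in auto)
  then show ?case by (simp add: shift_def zmul_def algebra_simps prod_eq_iff plus_prod_def)
qed

text \<open>Finitely many patterns occur on \<open>S\<close>, so going back along \<open>w'\<close>
  some pair of patterns of \<open>y\<close> and \<open>y'\<close> repeats, and coding forward turns
  the repetition into \<open>y s = y (s - j w')\<close> and the same for \<open>y'\<close>. For
  large \<open>j\<close> the right-hand sides are read in the half plane, where the configurations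
  agree. Only one point \<open>s\<close> is followed, so \<open>S\<close> itself may be
  infinite.\<close>

lemma expansive_if_icodes_translate:
  assumes X: "subshift A X" and "S \<noteq> {}" and fin: "finite ((\<lambda>x. restrict x S) ` X)"
    and fwd: "icodes X S ((+) w ` S)" and "cross2 d (to_plane w) \<noteq> 0"
  shows "expansive X (left_halfplane p d)"
proof -
  have "icodes X ((+) (- w) ` (+) w ` S) ((+) (- w) ` S)"
    by (rule icodes_translate[OF X icodes_backward[OF X fin fwd]])
  moreover have "(+) (- w) ` (+) w ` S = S" by (simp add: image_comp o_def)
  ultimately have bwd: "icodes X S ((+) (- w) ` S)" by simp
  \<comment> \<open>Coding in both directions allows the sign to be chosen such that steps against
    \<open>w'\<close> lead into the half plane.\<close>
  obtain w' where w': "icodes X S ((+) w' ` S)" "cross2 d (to_plane w') < 0"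
  proof (cases "cross2 d (to_plane w) < 0")
    case True
    then show ?thesis using that fwd by blast
  next
    case False
    then have "cross2 d (to_plane (- w)) < 0" using assms(5) by simp
    then show ?thesis using that bwd by blast
  qed
  obtain s where s: "s \<in> S" using \<open>S \<noteq> {}\<close> by blast
  have "x u = x' u" if x: "x \<in> X" "x' \<in> X" "\<And>u. to_plane u \<in> left_halfplane p d \<Longrightarrow> x u = x' u" for x x' u
  proof -
    define y where "y = shift (u - s) x"
    define y' where "y' = shift (u - s) x'"
    have y: "y \<in> X" "y' \<in> X" using shift_in[OF X] x by (auto simp: y_def y'_def)
    let ?b = "\<lambda>k y. shift (zmul (- int k) w') y"
    define P where "P k = (restrict (?b k y) S, restrict (?b k y') S)" for k
    have "range P \<subseteq> ((\<lambda>x. restrict x S) ` X) \<times> ((\<lambda>x. restrict x S) ` X)"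
      unfolding P_def using shift_in[OF X] y by blast
    then have "finite (range P)" using fin by (meson finite_SigmaI finite_subset)
    then obtain k0 where k0: "infinite {k. P k = P k0}"
      using pigeonhole_infinite[of "UNIV :: nat set" P] by auto
    \<comment> \<open>More than \<open>m\<close> steps back from \<open>u\<close> end in the half
      plane; the repetition is therefore taken more than \<open>m\<close> steps apart.\<close>
    obtain m :: nat where m: "real m * - cross2 d (to_plane w') > cross2 d p - cross2 d (to_plane u)"
      using reals_Archimedean3[of "- cross2 d (to_plane w')"] w'(2) by auto
    obtain k1 where k1: "k1 > k0 + m" "P k1 = P k0"
      using k0 unfolding infinite_nat_iff_unbounded by blast
    define j where "j = int k1 - int k0"
    have per: "z s = z (s - zmul j w')" if "z \<in> X" "restrict (?b k1 z) S = restrict (?b k0 z) S" for z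
    proof -
      have "shift (zmul (int k0) w') (?b k0 z) s = shift (zmul (int k0) w') (?b k1 z) s"
        by (rule icodes_iterate[OF X w'(1) shift_in[OF X that(1)] shift_in[OF X that(1)] _ s])
           (metis restrict_apply' that(2))
      then show ?thesis by (simp add: shift_def j_def zmul_def algebra_simps minus_prod_def plus_prod_def)
    qed
    have "x (u - zmul j w') = x' (u - zmul j w')"
    proof (rule x(3))
      have "real m * - cross2 d (to_plane w') \<le> of_int j * - cross2 d (to_plane w')"
        by (rule mult_right_mono) (use k1 w'(2) in \<open>auto simp: j_def\<close>)
      with m show "to_plane (u - zmul j w') \<in> left_halfplane p d" by (simp add: left_halfplane_def)
    qed
    then have "y (s - zmul j w') = y' (s - zmul j w')"
      by (simp add: y_def y'_def shift_def algebra_simps)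
    then have "y s = y' s" using per[OF y(1)] per[OF y(2)] k1(2) by (simp add: P_def)
    then show ?thesis by (simp add: y_def y'_def shift_def)
  qed
  then show ?thesis unfolding expansive_def codes_def by blast
qed

text \<open>If \<open>X\<close> were finite, the whole lattice would carry finitely many patterns
  and trivially code all its translates, which makes every direction expansive.\<close>

lemma infinite_if_nonexpansive:
  assumes X: "subshift A X" and "d \<noteq> 0" "\<not> expansive X (left_halfplane p d)"
  shows "infinite X"
proof
  assume fin: "finite X"
  obtain w where w: "cross2 d (to_plane w) > 0" using lattice_cross2_unbounded[OF \<open>d \<noteq> 0\<close>] .
  have "icodes X UNIV ((+) w ` UNIV)" unfolding icodes_def by blast
  from expansive_if_icodes_translate[OF X _ _ this] have "expansive X (left_halfplane p d)"
    using fin w by simp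
  with assms show False by blast
qed

section \<open>Consequences of finiteness, rationality and closing\<close>

locale closing_shift =
  fixes A :: "'a set" and X :: "'a config set"
  assumes X: "subshift A X"
    and fin: "finite (nonexp X)"
    and rational: "\<forall>l\<in>nonexpansive_rays X. rational_ray l"
    and closing: "\<forall>l\<in>nonexpansive_rays X. closing_ray X l"
begin

lemma nonexp_coprime: "v \<in> nonexp X \<Longrightarrow> coprime (fst v) (snd v)"
  by (simp add: nonexp_def)

lemma nonexp_parallel: "v \<in> nonexp X \<Longrightarrow> w \<in> nonexp X \<Longrightarrow> icross v w = 0 \<Longrightarrow> w = v \<or> w = - v"
  using primitive_parallel nonexp_coprime by blast

lemma nonexp_nonzero: "v \<in> nonexp X \<Longrightarrow> v \<noteq> 0"
  using nonexp_coprime[of v] by auto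

text \<open>A longer block is a stronger demand on \<open>K\<close>, so one number above the bounds
  of the finitely many directions serves them all.\<close>

lemma uniform_closing:
  obtains N :: nat where "N > 0"
    "\<And>v \<sigma> K. v \<in> nonexp X \<Longrightarrow> \<sigma> = 1 \<or> \<sigma> = -1 \<Longrightarrow>
        (\<And>t. 1 \<le> t \<Longrightarrow> t \<le> int N \<Longrightarrow> zmul (\<sigma> * t) v \<in> K) \<Longrightarrow>
        icodes X ({w. icross v w > 0} \<union> K) {0}"
proof -
  have "\<forall>v. \<exists>N::nat. v \<in> nonexp X \<longrightarrow> (\<forall>\<sigma> K. (\<sigma> = 1 \<or> \<sigma> = -1) \<longrightarrow>
        (\<forall>t. 1 \<le> t \<longrightarrow> t \<le> int N \<longrightarrow> zmul (\<sigma> * t) v \<in> K) \<longrightarrow>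
        icodes X ({w. icross v w > 0} \<union> K) {0})"
  proof
    fix v
    show "\<exists>N::nat. v \<in> nonexp X \<longrightarrow> (\<forall>\<sigma> K. (\<sigma> = 1 \<or> \<sigma> = -1) \<longrightarrow>
        (\<forall>t. 1 \<le> t \<longrightarrow> t \<le> int N \<longrightarrow> zmul (\<sigma> * t) v \<in> K) \<longrightarrow>
        icodes X ({w. icross v w > 0} \<union> K) {0})"
    proof (cases "v \<in> nonexp X")
      case True
      then have "closing_ray X (ray 0 (to_plane v))" using closing nonexp_ray by blast
      then obtain N :: nat where "\<And>\<sigma> K. \<sigma> = 1 \<or> \<sigma> = -1 \<Longrightarrow>
          (\<And>t. 1 \<le> t \<Longrightarrow> t \<le> int N \<Longrightarrow> zmul (\<sigma> * t) v \<in> K) \<Longrightarrow>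
          icodes X ({w. icross v w > 0} \<union> K) {0}"
        using closing_icodes[OF X nonexp_coprime[OF True]] by blast
      then show ?thesis by (intro exI[of _ N] impI allI) presburger
    qed simp
  qed
  then obtain M :: "int \<times> int \<Rightarrow> nat" where M: "\<And>v \<sigma> K. v \<in> nonexp X \<Longrightarrow> \<sigma> = 1 \<or> \<sigma> = -1 \<Longrightarrow>
        (\<forall>t. 1 \<le> t \<longrightarrow> t \<le> int (M v) \<longrightarrow> zmul (\<sigma> * t) v \<in> K) \<Longrightarrow>
        icodes X ({w. icross v w > 0} \<union> K) {0}"
    by metis
  have le: "M v \<le> Suc (\<Sum>v\<in>nonexp X. M v)" if "v \<in> nonexp X" for v
    using member_le_sum[OF that _ fin, of M] by simp
  show ?thesis
  proof (rule that[of "Suc (\<Sum>v\<in>nonexp X. M v)"])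
    fix v \<sigma> K
    assume v: "v \<in> nonexp X" and \<sigma>: "\<sigma> = 1 \<or> \<sigma> = -1"
      and K: "\<And>t. 1 \<le> t \<Longrightarrow> t \<le> int (Suc (\<Sum>v\<in>nonexp X. M v)) \<Longrightarrow> zmul (\<sigma> * t) v \<in> K"
    show "icodes X ({w. icross v w > 0} \<union> K) {0}"
    proof (rule M[OF v \<sigma>], intro allI impI)
      fix t assume t: "1 \<le> t" "t \<le> int (M v)"
      moreover have "int (M v) \<le> int (Suc (\<Sum>v\<in>nonexp X. M v))" using le[OF v] by (simp only: of_nat_le_iff)
      ultimately show "zmul (\<sigma> * t) v \<in> K" by (intro K) linarith+
    qed
  qed simp
qed

text \<open>A limit direction in \<open>disc_coding\<close> is either expansive or that of some nonexpansive \<open>v\<close>; in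
  the second case a block of \<open>Z\<close> along \<open>v\<close> lets the closing condition take over.\<close>

lemma disc_coding_closing:
  assumes Z: "finite Z" "Z \<noteq> {}"
    and K: "\<And>v. v \<in> nonexp X \<Longrightarrow> (\<And>z. z \<in> Z \<Longrightarrow> icross v z \<ge> 0) \<Longrightarrow>
      \<exists>\<sigma>. (\<sigma> = 1 \<or> \<sigma> = -1) \<and> (\<forall>t. 1 \<le> t \<longrightarrow> t \<le> int N \<longrightarrow> zmul (\<sigma> * t) v \<in> Z)"
    and N: "N > 0" "\<And>v \<sigma> K. v \<in> nonexp X \<Longrightarrow> \<sigma> = 1 \<or> \<sigma> = -1 \<Longrightarrow>
        (\<And>t. 1 \<le> t \<Longrightarrow> t \<le> int N \<Longrightarrow> zmul (\<sigma> * t) v \<in> K) \<Longrightarrow>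
        icodes X ({w. icross v w > 0} \<union> K) {0}"
  shows "\<forall>\<^sub>F r in at_top. icodes X (\<Union>z\<in>Z. (+) z ` disc r) (disc r)"
proof (rule disc_coding[OF X Z])
  fix n :: "real \<times> real"
  assume n: "norm n = 1" and polar: "\<And>z. z \<in> Z \<Longrightarrow> n \<bullet> to_plane z \<le> 0"
  \<comment> \<open>\<open>n\<close> turned counterclockwise by a right angle, so that the half
    plane to the left of \<open>d\<close> is the one with outer normal \<open>n\<close>.\<close>
  define d where "d = (- snd n, fst n)"
  have d: "cross2 d u = - (n \<bullet> u)" for u by (simp add: d_def cross2_def inner_prod_def)
  have "norm d = 1" using n by (simp add: d_def norm_prod_def add.commute)
  then have d0: "d \<noteq> 0" by auto
  obtain z where z: "z \<in> Z" using Z by blast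
  show "icodes X ({w. \<exists>z\<in>Z. n \<bullet> to_plane w < n \<bullet> to_plane z} \<union> Z) {0}"
  proof (cases "expansive X (left_halfplane 0 d)")
    case True
    show ?thesis
      by (rule expansive_icodes[OF X d0 True, of "cross2 d (to_plane z)"]) (use z in \<open>auto simp: d\<close>)
  next
    case False
    then obtain v c where v: "v \<in> nonexp X" "c > 0" "d = c *\<^sub>R to_plane v"
      using nonexp_direction[OF X rational d0] by blast
    have nv: "n \<bullet> to_plane u = - (c * of_int (icross v u))" for u
      using d[of "to_plane u"] v(3) by simp
    have "icross v z \<ge> 0" if "z \<in> Z" for z
      using polar[OF that] v(2) unfolding nv by (simp add: zero_le_mult_iff)
    then obtain \<sigma> where \<sigma>: "\<sigma> = 1 \<or> \<sigma> = -1" "\<And>t. 1 \<le> t \<Longrightarrow> t \<le> int N \<Longrightarrow> zmul (\<sigma> * t) v \<in> Z"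
      using K[OF v(1)] by blast
    \<comment> \<open>The first block point has level \<open>0\<close>, so every point with positive
      \<open>icross v\<close> lies strictly below it in direction \<open>n\<close>.\<close>
    have "zmul \<sigma> v \<in> Z" using \<sigma>(2)[of 1] N(1) by simp
    moreover have "n \<bullet> to_plane w < n \<bullet> to_plane (zmul \<sigma> v)" if "icross v w > 0" for w
      unfolding nv using that v(2) by simp
    ultimately have "{w. icross v w > 0} \<union> Z \<subseteq> {w. \<exists>z\<in>Z. n \<bullet> to_plane w < n \<bullet> to_plane z} \<union> Z"
      by blast
    then show ?thesis using N(2)[OF v(1) \<sigma>(1), of Z] \<sigma>(2) icodes_mono by blast
  qed
qed

text \<open>A union of translates of a large disc along \<open>w\<close> codes its own translate by \<open>w\<close>.\<close>

lemma nonexp_not_one_sided: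
  assumes le: "\<And>v. v \<in> nonexp X \<Longrightarrow> icross w v \<le> 0"
    and par: "\<And>v. v \<in> nonexp X \<Longrightarrow> icross w v = 0 \<Longrightarrow> w = v \<or> w = - v"
    and v: "v \<in> nonexp X"
  shows "icross w v = 0"
proof (rule ccontr)
  assume ne: "icross w v \<noteq> 0"
  obtain N :: nat where N: "N > 0" "\<And>v \<sigma> K. v \<in> nonexp X \<Longrightarrow> \<sigma> = 1 \<or> \<sigma> = -1 \<Longrightarrow>
        (\<And>t. 1 \<le> t \<Longrightarrow> t \<le> int N \<Longrightarrow> zmul (\<sigma> * t) v \<in> K) \<Longrightarrow>
        icodes X ({w. icross v w > 0} \<union> K) {0}"
    using uniform_closing by blast
  \<comment> \<open>A row of \<open>N\<close> centres behind the origin along \<open>w\<close>; it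
    doubles as the block when a nonexpansive direction is parallel to \<open>w\<close>.\<close>
  define Z where "Z = (\<lambda>t. zmul (- t) w) ` {1..int N}"
  have Z: "finite Z" "Z \<noteq> {}" using N(1) by (auto simp: Z_def)
  have inZ: "zmul (- t) w \<in> Z" if "1 \<le> t" "t \<le> int N" for t using that by (auto simp: Z_def)
  have "\<forall>\<^sub>F r in at_top. icodes X (\<Union>z\<in>Z. (+) z ` disc r) (disc r)"
  proof (rule disc_coding_closing[OF Z _ N])
    fix u assume u: "u \<in> nonexp X" and pos: "\<And>z. z \<in> Z \<Longrightarrow> icross u z \<ge> 0"
    \<comment> \<open>Having \<open>- w\<close> weakly on its left puts \<open>u\<close> weakly to
      the left of \<open>w\<close>, while \<open>le\<close> puts it weakly to the right; hence the
      two are parallel.\<close>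
    have "icross u (- w) \<ge> 0" using pos[OF inZ[of 1]] N(1) by simp
    then have "icross w u = 0" using le[OF u] icross_swap[of w u] by simp
    then have "w = u \<or> w = - u" by (rule par[OF u])
    then show "\<exists>\<sigma>. (\<sigma> = 1 \<or> \<sigma> = -1) \<and> (\<forall>t. 1 \<le> t \<longrightarrow> t \<le> int N \<longrightarrow> zmul (\<sigma> * t) u \<in> Z)"
    proof
      assume "w = u"
      then show ?thesis using inZ by (intro exI[of _ "-1"]) auto
    next
      assume "w = - u"
      then show ?thesis using inZ by (intro exI[of _ 1]) auto
    qed
  qed
  then obtain r where r: "r \<ge> 0" "icodes X (\<Union>z\<in>Z. (+) z ` disc r) (disc r)"
    unfolding eventually_at_top_linorder by (metis nle_le)
  \<comment> \<open>The discs about \<open>0\<close>, \<open>- w\<close>, ...,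
    \<open>- (N - 1) w\<close>. Moving by \<open>w\<close> adds only the disc about
    \<open>w\<close>, and that one is coded.\<close>
  define S where "S = (+) w ` (\<Union>z\<in>Z. (+) z ` disc r)"
  have cod: "icodes X S ((+) w ` disc r)"
    unfolding S_def by (rule icodes_translate[OF X r(2)])
  have "icodes X S ((+) w ` S)"
    unfolding icodes_def
  proof (intro ballI impI)
    fix x x' q assume x: "x \<in> X" "x' \<in> X" "\<forall>u\<in>S. x u = x' u" and "q \<in> (+) w ` S"
    then obtain t f where t: "1 \<le> t" "t \<le> int N" "f \<in> disc r" "q = w + (w + (zmul (- t) w + f))"
      by (auto simp: S_def Z_def)
    show "x q = x' q"
    proof (cases "t = 1")
      case True
      then have "q \<in> (+) w ` disc r" using t by simp
      then show ?thesis using icodesD[OF cod x(1,2)] x(3) by blast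
    next
      case False
      then have "zmul (- (t - 1)) w \<in> Z" using t by (intro inZ) auto
      moreover have "q = w + (zmul (- (t - 1)) w + f)"
        using t(4) by (simp add: zmul_def prod_eq_iff algebra_simps)
      ultimately have "q \<in> S" using t(3) unfolding S_def by blast
      then show ?thesis using x(3) by blast
    qed
  qed
  moreover have "S \<noteq> {}"
  proof -
    have "0 \<in> disc r" using r(1) by (simp add: disc_def)
    then show ?thesis using Z(2) unfolding S_def by blast
  qed
  moreover have "finite ((\<lambda>x. restrict x S) ` X)"
  proof (rule finite_subset)
    show "(\<lambda>x. restrict x S) ` X \<subseteq> S \<rightarrow>\<^sub>E A" using subshift_value[OF X] by auto
    have "finite S" using Z(1) finite_disc by (simp add: S_def)
    then show "finite (S \<rightarrow>\<^sub>E A)" using X by (intro finite_PiE) (auto simp: subshift_def)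
  qed
  moreover have "cross2 (to_plane v) (to_plane w) \<noteq> 0"
    using ne icross_swap[of v w] by simp
  ultimately have "expansive X (left_halfplane 0 (to_plane v))"
    using expansive_if_icodes_translate[OF X] by blast
  then show False using v by (simp add: nonexp_def)
qed

text \<open>Unless \<open>- v\<close> is nonexpansive, let \<open>a\<close> be turned farthest to the left from \<open>v\<close>; since the
  directions do not all lie to the right of \<open>a\<close>, some \<open>b\<close> to the right of \<open>v\<close> lies to the left
  of \<open>a\<close>.\<close>

lemma nonexp_balanced:
  assumes v0: "v \<in> nonexp X"
  obtains a b \<alpha> \<beta> \<gamma> where "a \<in> nonexp X" "b \<in> nonexp X" "\<alpha> \<ge> 0" "\<beta> \<ge> 0" "\<gamma> > 0"
    "zmul \<gamma> v + zmul \<alpha> a + zmul \<beta> b = 0"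
proof (cases "- v \<in> nonexp X")
  case True
  then show ?thesis using that[of "- v" "- v" 1 0 1] by simp
next
  case False
  have v_sq: "fst v * fst v + snd v * snd v > 0"
  proof -
    have "fst v \<noteq> 0 \<or> snd v \<noteq> 0" using nonexp_nonzero[OF v0] by (simp add: prod_eq_iff)
    then show ?thesis by (meson sum_squares_gt_zero_iff)
  qed
  have par: "u = v" if "u \<in> nonexp X" "icross v u = 0" for u
    using nonexp_parallel[OF v0 that] that(1) False by auto
  have right: "\<exists>b\<in>nonexp X. icross v b < 0" if "u \<in> nonexp X" "icross v u \<noteq> 0" for u
  proof (rule ccontr)
    assume c: "\<not> (\<exists>b\<in>nonexp X. icross v b < 0)"
    have "icross (- v) u = 0"
      by (rule nonexp_not_one_sided[OF _ _ that(1)]) (use c par in force)+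
    with that show False by simp
  qed
  have left: "\<exists>b\<in>nonexp X. icross v b > 0" if "u \<in> nonexp X" "icross v u \<noteq> 0" for u
  proof (rule ccontr)
    assume c: "\<not> (\<exists>b\<in>nonexp X. icross v b > 0)"
    have "icross v u = 0"
      by (rule nonexp_not_one_sided[OF _ _ that(1)]) (use c par in force)+
    with that show False by simp
  qed
  have "\<exists>u\<in>nonexp X. icross v u \<noteq> 0"
  proof (rule ccontr)
    assume c: "\<not> (\<exists>u\<in>nonexp X. icross v u \<noteq> 0)"
    \<comment> \<open>If \<open>v\<close> were the only direction, all directions would lie strictly
      to one side of this perpendicular vector.\<close>
    define w where "w = (- snd v, fst v)"
    have w: "icross w v < 0" using v_sq by (simp add: icross_def w_def)
    have only: "u = v" if "u \<in> nonexp X" for u using par[OF that] c that by blast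
    have "icross w v = 0"
      by (rule nonexp_not_one_sided[OF _ _ v0]) (use only w in auto)
    with w show False by simp
  qed
  then obtain u where u: "u \<in> nonexp X" "icross v u \<noteq> 0" by blast
  define Lf where "Lf = {a \<in> nonexp X. icross v a > 0}"
  have Lf: "finite Lf" "Lf \<noteq> {}" using fin left[OF u] by (auto simp: Lf_def)
  define dot where "dot a = fst v * fst a + snd v * snd a" for a
  \<comment> \<open>Minus the cotangent of the angle from \<open>v\<close> to \<open>a\<close>,
    which increases on angles between \<open>0\<close> and \<pi>; comparing values amounts to the
    sign of \<open>icross a a'\<close>.\<close>
  define \<kappa> where "\<kappa> a = - real_of_int (dot a) / real_of_int (icross v a)" for a
  obtain a where a: "a \<in> Lf" "\<And>a'. a' \<in> Lf \<Longrightarrow> \<kappa> a' \<le> \<kappa> a"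
  proof -
    have "Max (\<kappa> ` Lf) \<in> \<kappa> ` Lf" using Lf by (intro Max_in) auto
    then obtain a where "a \<in> Lf" "Max (\<kappa> ` Lf) = \<kappa> a" by blast
    moreover have "\<kappa> a' \<le> Max (\<kappa> ` Lf)" if "a' \<in> Lf" for a' using Lf(1) that by (intro Max_ge) auto
    ultimately show ?thesis using that by simp
  qed
  have extremal: "icross a a' \<le> 0" if "a' \<in> Lf" for a'
  proof -
    have pos: "icross v a > 0" "icross v a' > 0" using a(1) that by (auto simp: Lf_def)
    have "- real_of_int (dot a') / real_of_int (icross v a') \<le> - real_of_int (dot a) / real_of_int (icross v a)"
      using a(2)[OF that] unfolding \<kappa>_def .
    then have "real_of_int (dot a) * of_int (icross v a') \<le> real_of_int (dot a') * of_int (icross v a)"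
      using pos by (simp add: field_simps)
    then have "dot a * icross v a' - dot a' * icross v a \<le> 0"
      by (metis diff_le_0_iff_le of_int_le_iff of_int_mult)
    moreover have "dot a * icross v a' - dot a' * icross v a = (fst v * fst v + snd v * snd v) * icross a a'"
      by (simp add: dot_def icross_def algebra_simps)
    ultimately show ?thesis using v_sq by (simp add: mult_le_0_iff)
  qed
  have aV: "a \<in> nonexp X" "icross v a > 0" using a(1) by (auto simp: Lf_def)
  have "\<exists>b\<in>nonexp X. icross v b < 0 \<and> icross a b > 0"
  proof (rule ccontr)
    assume c: "\<not> (\<exists>b\<in>nonexp X. icross v b < 0 \<and> icross a b > 0)"
    have "icross a b \<le> 0" if "b \<in> nonexp X" for b
    proof (cases "icross v b" "0 :: int" rule: linorder_cases)
      case less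
      then show ?thesis using c that by force
    next
      case equal
      then show ?thesis using par[OF that] aV(2) icross_swap[of a v] by simp
    next
      case greater
      then show ?thesis using extremal[of b] that by (simp add: Lf_def)
    qed
    moreover have "a = u \<or> a = - u" if "u \<in> nonexp X" "icross a u = 0" for u
      using nonexp_parallel[OF aV(1) that] by auto
    ultimately have "icross a v = 0" by (rule nonexp_not_one_sided[OF _ _ v0])
    then show False using aV(2) icross_swap[of a v] by simp
  qed
  then obtain b where b: "b \<in> nonexp X" "icross v b < 0" "icross a b > 0" by blast
  show ?thesis
  \<comment> \<open>Any three plane vectors are related with their pairwise cross products as
    coefficients; the positions of \<open>a\<close> and \<open>b\<close> make all three
    positive.\<close>
  proof (rule that[of a b "icross b v" "icross v a" "icross a b"])
    show "zmul (icross a b) v + zmul (icross b v) a + zmul (icross v a) b = 0"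
      by (simp add: zmul_def icross_def prod_eq_iff algebra_simps)
    show "icross b v \<ge> 0" using b(2) icross_swap[of b v] by simp
  qed (use aV b in auto)
qed

end

section \<open>Polygons with prescribed edge directions\<close>

lemma convex_line_between:
  assumes "convex P" "x + s *\<^sub>R v \<in> P" "x + r *\<^sub>R v \<in> P" "s \<le> \<tau>" "\<tau> \<le> r"
  shows "x + \<tau> *\<^sub>R v \<in> P"
proof (cases "s = r")
  case True
  then show ?thesis using assms by simp
next
  case False
  define l where "l = (\<tau> - s) / (r - s)"
  have l: "0 \<le> l" "l \<le> 1" using assms(4,5) False by (auto simp: l_def)
  have "l * (r - s) = \<tau> - s" using False by (simp add: l_def)
  then have \<tau>: "\<tau> = (1 - l) * s + l * r" by (simp add: algebra_simps)
  have "(1 - l) *\<^sub>R (x + s *\<^sub>R v) + l *\<^sub>R (x + r *\<^sub>R v) \<in> P"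
    using assms(1-3) l by (intro convexD) auto
  also have "(1 - l) *\<^sub>R (x + s *\<^sub>R v) + l *\<^sub>R (x + r *\<^sub>R v) = x + \<tau> *\<^sub>R v"
    unfolding \<tau> by (simp add: algebra_simps)
  finally show ?thesis .
qed

lemma closed_segment_edge_of_self: "a \<noteq> b \<Longrightarrow> closed_segment a b edge_of closed_segment a b"
  by (simp add: edge_of_def face_of_refl segment_convex_hull aff_dim_convex_hull)

text \<open>\<open>balanced\<close> puts \<open>- v\<close> in the cone spanned by two members,
  which bounds an intersection of half planes lying to the left of the members.
  \<open>parallel\<close> is what remains of primitivity.\<close>

locale direction_set =
  fixes V :: "(int \<times> int) set"
  assumes fin: "finite V" and nonempty: "V \<noteq> {}"
    and nonzero: "\<And>v. v \<in> V \<Longrightarrow> v \<noteq> 0"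
    and parallel: "\<And>v w. v \<in> V \<Longrightarrow> w \<in> V \<Longrightarrow> icross v w = 0 \<Longrightarrow> w = v \<or> w = - v"
    and balanced: "\<And>v. v \<in> V \<Longrightarrow> \<exists>a\<in>V. \<exists>b\<in>V. \<exists>\<alpha>\<ge>0. \<exists>\<beta>\<ge>0. \<exists>\<gamma>>0.
      zmul \<gamma> v + zmul \<alpha> a + zmul \<beta> b = 0"
begin

text \<open>The last clause is how long edges are used: if \<open>P\<close> lies to the left of the
  line through the vertex \<open>p\<close> along \<open>v\<close>, then \<open>N\<close> lattice
  steps from \<open>p\<close>, along \<open>v\<close> or against it, stay in \<open>P\<close>.
  Closing needs a block on one side only, so both ends of an edge qualify.\<close>

definition edge_polygon :: "nat \<Rightarrow> (real \<times> real) set \<Rightarrow> bool" where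
  "edge_polygon N P \<longleftrightarrow> convex_integer_polygon P \<and>
    (\<forall>v\<in>V. \<exists>a b. \<exists>c>0. oriented_edge P a b \<and> b - a = c *\<^sub>R to_plane v) \<and>
    (\<forall>a b. oriented_edge P a b \<longrightarrow> (\<exists>v\<in>V. \<exists>c>0. b - a = c *\<^sub>R to_plane v)) \<and>
    (\<forall>v\<in>V. \<forall>p. p extreme_point_of P \<longrightarrow> (\<forall>q\<in>P. cross2 (to_plane v) (q - p) \<ge> 0) \<longrightarrow>
       (\<exists>\<sigma>. (\<sigma> = 1 \<or> \<sigma> = -1) \<and>
          (\<forall>t. 1 \<le> t \<longrightarrow> t \<le> int N \<longrightarrow> p + to_plane (zmul (\<sigma> * t) v) \<in> P)))"

text \<open>When all members are parallel, balance forces \<open>- v\<close> to accompany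
  \<open>v\<close>, and a segment with its two orientations realises both.\<close>

lemma edge_polygon_segment:
  assumes "N > 0" and deg: "\<And>u v. u \<in> V \<Longrightarrow> v \<in> V \<Longrightarrow> icross u v = 0"
  shows "\<exists>P. edge_polygon N P"
proof -
  obtain v where v: "v \<in> V" using nonempty by blast
  have V1: "u = v \<or> u = - v" if "u \<in> V" for u using parallel[OF v that deg[OF v that]] .
  have v0: "to_plane v \<noteq> 0" using nonzero[OF v] to_plane_inject[of v 0] by simp
  have mv: "- v \<in> V"
  proof (rule ccontr)
    assume "- v \<notin> V"
    then have "V = {v}" using V1 v by blast
    then obtain \<alpha> \<beta> \<gamma> where "\<alpha> \<ge> 0" "\<beta> \<ge> 0" "\<gamma> > 0" "zmul \<gamma> v + zmul \<alpha> v + zmul \<beta> v = 0"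
      using balanced[OF v] by auto
    moreover from this(4) have "(\<gamma> + \<alpha> + \<beta>) * fst v = 0" "(\<gamma> + \<alpha> + \<beta>) * snd v = 0"
      by (auto simp: zmul_def prod_eq_iff algebra_simps)
    ultimately show False using nonzero[OF v] by (auto simp: prod_eq_iff)
  qed
  define e where "e = real N *\<^sub>R to_plane v"
  define P where "P = closed_segment 0 e"
  have e0: "e \<noteq> 0" using v0 assms(1) by (simp add: e_def)
  have inP: "q \<in> P \<longleftrightarrow> (\<exists>s. 0 \<le> s \<and> s \<le> 1 \<and> q = (s * real N) *\<^sub>R to_plane v)" for q
    by (auto simp: P_def in_segment e_def)
  have onP: "t *\<^sub>R to_plane v \<in> P" if "0 \<le> t" "t \<le> real N" for t
    unfolding inP using that assms(1) by (intro exI[of _ "t / real N"]) auto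
  have left: "P \<subseteq> left_halfplane a (c *\<^sub>R to_plane v)" if "a \<in> P" for a c
    using that by (auto simp: inP left_halfplane_def)
  have ends: "0 \<in> P" "e \<in> P" by (auto simp: P_def)
  have edge: "oriented_edge P 0 e" "oriented_edge P e 0"
    using closed_segment_edge_of_self[of 0 e] e0 left[OF ends(1), of "real N"] left[OF ends(2), of "- real N"]
    by (auto simp: oriented_edge_def P_def e_def closed_segment_commute)
  have "edge_polygon N P"
    unfolding edge_polygon_def
  proof (intro conjI ballI allI impI)
    have "aff_dim P = 1" using e0 by (simp add: P_def segment_convex_hull aff_dim_convex_hull)
    moreover have "polytope P" unfolding P_def by (simp add: segment_convex_hull polytope_convex_hull)
    moreover have "e = to_plane (zmul (int N) v)" by (simp add: e_def)
    ultimately show "convex_integer_polygon P"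
      unfolding convex_integer_polygon_def P_def extreme_point_of_segment
      by (metis (no_types) order_refl rangeI to_plane_simps(4))
  next
    fix u assume "u \<in> V"
    then consider "u = v" | "u = - v" using V1 by blast
    then show "\<exists>a b. \<exists>c>0. oriented_edge P a b \<and> b - a = c *\<^sub>R to_plane u"
    proof cases
      case 1
      then show ?thesis using edge(1) assms(1)
        by (intro exI[of _ 0] exI[of _ e] exI[of _ "real N"]) (simp add: e_def)
    next
      case 2
      then show ?thesis using edge(2) assms(1)
        by (intro exI[of _ e] exI[of _ 0] exI[of _ "real N"]) (simp add: e_def)
    qed
  next
    fix a b assume ab: "oriented_edge P a b"
    then have "closed_segment a b \<subseteq> P" "a \<noteq> b" by (auto simp: oriented_edge_def edge_of_imp_subset)
    then have "a \<in> P" "b \<in> P" by auto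
    then obtain s r where "b = (s * real N) *\<^sub>R to_plane v" "a = (r * real N) *\<^sub>R to_plane v"
      unfolding inP by blast
    then have t: "b - a = (s * real N - r * real N) *\<^sub>R to_plane v" by (simp add: scaleR_left_diff_distrib)
    show "\<exists>u\<in>V. \<exists>c>0. b - a = c *\<^sub>R to_plane u"
    proof (cases "s * real N - r * real N > 0")
      case True
      then show ?thesis using t v by blast
    next
      case False
      have "s * real N - r * real N \<noteq> 0"
      proof
        assume "s * real N - r * real N = 0"
        then have "b - a = 0" unfolding t by simp
        then show False using \<open>a \<noteq> b\<close> by simp
      qed
      with False have "r * real N - s * real N > 0" by linarith
      moreover have "b - a = (r * real N - s * real N) *\<^sub>R to_plane (- v)"
        using t by (simp add: algebra_simps)
      ultimately show ?thesis using mv by blast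
    qed
  next
    fix u p assume u: "u \<in> V" and "p extreme_point_of P"
    then have p: "p = 0 \<or> p = e" by (simp add: P_def extreme_point_of_segment)
    obtain \<epsilon> :: int where \<epsilon>: "\<epsilon> = 1 \<or> \<epsilon> = -1" "u = zmul \<epsilon> v"
      using V1[OF u] by (metis zmul_simps(1,2))
    have ee: "\<epsilon> * \<epsilon> = 1" using \<epsilon>(1) by auto
    show "\<exists>\<sigma>. (\<sigma> = 1 \<or> \<sigma> = -1) \<and>
        (\<forall>t. 1 \<le> t \<longrightarrow> t \<le> int N \<longrightarrow> p + to_plane (zmul (\<sigma> * t) u) \<in> P)"
      using p
    proof
      assume "p = 0"
      then show ?thesis using \<epsilon> by (intro exI[of _ \<epsilon>]) (auto intro!: onP)
    next
      assume "p = e"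
      then show ?thesis using \<epsilon>
        by (intro exI[of _ "- \<epsilon>"]) (auto simp: e_def simp flip: scaleR_left_diff_distrib intro!: onP)
    qed
  qed
  then show ?thesis by blast
qed

text \<open>The polygon is cut out by the support function of the zonotope spanned by \<open>V\<close>.  Hence it
  contains that zonotope and, for each \<open>v\<close>, the edge of the zonotope in direction \<open>v\<close> lies on its
  boundary.  The factor \<open>m\<close> makes the vertices integral by Cramer's rule.\<close>

definition height :: "int \<Rightarrow> int \<times> int \<Rightarrow> int" where
  "height m v = m * (\<Sum>u\<in>V. \<bar>icross v u\<bar>)"

definition zpoly :: "int \<Rightarrow> (real \<times> real) set" where
  "zpoly m = {q. \<forall>v\<in>V. cross2 (to_plane v) q \<ge> - of_int (height m v)}"

text \<open>The zonotope is the sum of the segments from \<open>- m u\<close> to \<open>m u\<close>.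
  Choosing signs against \<open>icross v u\<close> minimises \<open>icross v\<close>; as
  \<open>sgn 0 = 0\<close>, vectors parallel to \<open>v\<close> contribute nothing, which gives the
  midpoint of the edge in direction \<open>v\<close>.\<close>

definition zpoint :: "int \<Rightarrow> int \<times> int \<Rightarrow> int \<times> int" where
  "zpoint m v = zmul (- m) (\<Sum>u\<in>V. zmul (sgn (icross v u)) u)"

lemma icross_sum: "icross w (\<Sum>u\<in>U. f u) = (\<Sum>u\<in>U. icross w (f u))"
  by (induction U rule: infinite_finite_induct) simp_all

lemma icross_zpoint: "icross w (zpoint m v) = - m * (\<Sum>u\<in>V. sgn (icross v u) * icross w u)"
  by (simp add: zpoint_def icross_sum)

lemma zpoint_on_line: "icross v (zpoint m v) = - height m v"
  by (simp add: icross_zpoint height_def abs_sgn mult.commute)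

text \<open>At \<open>zpoint m v\<close> the slack in the constraint of \<open>w\<close> is
  \<open>m\<close> times a sum of nonnegative terms \<open>f u\<close>; the term with
  \<open>u = v\<close> alone pays for a displacement of up to \<open>m\<close> steps along
  \<open>v\<close>.\<close>

lemma zpoint_in_zpoly:
  assumes v: "v \<in> V" and m: "m \<ge> 0" and t: "\<bar>t\<bar> \<le> of_int m"
  shows "to_plane (zpoint m v) + t *\<^sub>R to_plane v \<in> zpoly m"
  unfolding zpoly_def
proof (intro CollectI ballI)
  fix w assume w: "w \<in> V"
  define f where "f u = \<bar>icross w u\<bar> - sgn (icross v u) * icross w u" for u
  have "f u \<ge> 0" for u by (auto simp: f_def sgn_if)
  then have "f v \<le> sum f V" using v fin by (intro member_le_sum) auto
  moreover have "f v = \<bar>icross w v\<bar>" by (simp add: f_def)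
  moreover have "sum f V = (\<Sum>u\<in>V. \<bar>icross w u\<bar>) - (\<Sum>u\<in>V. sgn (icross v u) * icross w u)"
    by (simp add: f_def sum_subtractf)
  ultimately have "m * \<bar>icross w v\<bar> \<le> m * ((\<Sum>u\<in>V. \<bar>icross w u\<bar>) - (\<Sum>u\<in>V. sgn (icross v u) * icross w u))"
    using m by (intro mult_left_mono) auto
  then have "m * \<bar>icross w v\<bar> \<le> height m w + icross w (zpoint m v)"
    by (simp add: height_def icross_zpoint algebra_simps)
  then have "real_of_int (m * \<bar>icross w v\<bar>) \<le> real_of_int (height m w + icross w (zpoint m v))"
    by (simp only: of_int_le_iff)
  moreover have "\<bar>t\<bar> * \<bar>real_of_int (icross w v)\<bar> \<le> of_int m * \<bar>real_of_int (icross w v)\<bar>"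
    using t by (intro mult_right_mono) auto
  moreover have "- (t * real_of_int (icross w v)) \<le> \<bar>t\<bar> * \<bar>real_of_int (icross w v)\<bar>"
    by (metis abs_ge_minus_self abs_mult)
  ultimately show "- of_int (height m w) \<le> cross2 (to_plane w) (to_plane (zpoint m v) + t *\<^sub>R to_plane v)"
    by simp
qed

section \<open>Boundedness, vertices and edges of the polygon\<close>

lemma polyhedron_zpoly: "polyhedron (zpoly m)"
proof -
  have "zpoly m = (\<Inter>v\<in>V. {q. (- snd (to_plane v), fst (to_plane v)) \<bullet> q \<ge> - of_int (height m v)})"
    by (auto simp: zpoly_def cross2_eq_inner)
  also have "polyhedron \<dots>" using fin by (intro polyhedron_Inter) (auto simp: polyhedron_halfspace_ge)
  finally show ?thesis .
qed

text \<open>Each \<open>cross2 v\<close> is bounded below by definition, and above because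
  \<open>balanced\<close> expresses a negative multiple of it... as a nonnegative combination of two
  others. Two independent functionals bound the point by Cramer's rule.\<close>

lemma bounded_zpoly:
  assumes u: "u \<in> V" "w \<in> V" "icross u w \<noteq> 0"
  shows "bounded (zpoly m)"
proof -
  have "\<exists>C. \<forall>q\<in>zpoly m. \<bar>cross2 (to_plane v) q\<bar> \<le> C" if v: "v \<in> V" for v
  proof -
    obtain a b \<alpha> \<beta> \<gamma> where ab: "a \<in> V" "b \<in> V" "\<alpha> \<ge> 0" "\<beta> \<ge> 0" "\<gamma> > 0"
      and 0: "zmul \<gamma> v + zmul \<alpha> a + zmul \<beta> b = 0"
      using balanced[OF v] by blast
    define h where "h v = real_of_int (height m v)" for v
    have "\<bar>cross2 (to_plane v) q\<bar> \<le> max (h v) ((\<alpha> * h a + \<beta> * h b) / \<gamma>)" if q: "q \<in> zpoly m" for q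
    proof -
      have c: "cross2 (to_plane v) q \<ge> - h v" "cross2 (to_plane a) q \<ge> - h a" "cross2 (to_plane b) q \<ge> - h b"
        using q v ab by (auto simp: zpoly_def h_def)
      have "cross2 (to_plane (zmul \<gamma> v + zmul \<alpha> a + zmul \<beta> b)) q = 0" unfolding 0 by simp
      then have "\<gamma> * cross2 (to_plane v) q = \<alpha> * - cross2 (to_plane a) q + \<beta> * - cross2 (to_plane b) q"
        by (simp add: cross2_def algebra_simps)
      also have "\<dots> \<le> \<alpha> * h a + \<beta> * h b"
        using ab c by (intro add_mono mult_left_mono) auto
      finally have "cross2 (to_plane v) q \<le> (\<alpha> * h a + \<beta> * h b) / \<gamma>"
        using ab(5) by (simp add: pos_le_divide_eq mult.commute)
      with c(1) show ?thesis by linarith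
    qed
    then show ?thesis by blast
  qed
  then obtain C D where C: "\<And>q. q \<in> zpoly m \<Longrightarrow> \<bar>cross2 (to_plane u) q\<bar> \<le> C"
    and D: "\<And>q. q \<in> zpoly m \<Longrightarrow> \<bar>cross2 (to_plane w) q\<bar> \<le> D"
    using u by meson
  let ?c = "real_of_int (icross u w)"
  show ?thesis
    unfolding bounded_iff
  proof (intro exI ballI)
    fix q assume q: "q \<in> zpoly m"
    have "?c *\<^sub>R q = cross2 (to_plane u) q *\<^sub>R to_plane w - cross2 (to_plane w) q *\<^sub>R to_plane u"
      unfolding cross2_to_plane[symmetric] by (simp add: cross2_def prod_eq_iff algebra_simps)
    then have "\<bar>?c\<bar> * norm q \<le> \<bar>cross2 (to_plane u) q\<bar> * norm (to_plane w) + \<bar>cross2 (to_plane w) q\<bar> * norm (to_plane u)"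
      by (metis norm_scaleR norm_triangle_ineq4)
    also have "\<dots> \<le> C * norm (to_plane w) + D * norm (to_plane u)"
      using C[OF q] D[OF q] by (intro add_mono mult_right_mono) auto
    finally show "norm q \<le> (C * norm (to_plane w) + D * norm (to_plane u)) / \<bar>?c\<bar>"
      using u(3) by (simp add: pos_le_divide_eq mult.commute)
  qed
qed

text \<open>The constraints tight at \<open>p\<close> do not see \<open>d\<close>, and the finitely
  many others leave room for a small step either way.\<close>

lemma zpoly_perturb:
  assumes p: "p \<in> zpoly m"
    and d: "\<And>v. v \<in> V \<Longrightarrow> cross2 (to_plane v) p = - of_int (height m v) \<Longrightarrow> cross2 (to_plane v) d = 0"
  obtains \<epsilon> where "\<epsilon> > 0" "p + \<epsilon> *\<^sub>R d \<in> zpoly m" "p - \<epsilon> *\<^sub>R d \<in> zpoly m"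
proof -
  let ?Q = "\<lambda>\<epsilon> v. cross2 (to_plane v) (p + \<epsilon> *\<^sub>R d) \<ge> - of_int (height m v) \<and>
      cross2 (to_plane v) (p - \<epsilon> *\<^sub>R d) \<ge> - of_int (height m v)"
  have "\<forall>\<^sub>F \<epsilon> in at_right 0. ?Q \<epsilon> v" if v: "v \<in> V" for v
  proof (cases "cross2 (to_plane v) p = - of_int (height m v)")
    case True
    then show ?thesis using d[OF v True] by simp
  next
    case False
    then have gt: "cross2 (to_plane v) p > - of_int (height m v)" using p v by (force simp: zpoly_def)
    have "((\<lambda>\<epsilon>. cross2 (to_plane v) p + \<epsilon> * cross2 (to_plane v) d) \<longlongrightarrow> cross2 (to_plane v) p + 0 * cross2 (to_plane v) d) (at_right 0)"
      "((\<lambda>\<epsilon>. cross2 (to_plane v) p - \<epsilon> * cross2 (to_plane v) d) \<longlongrightarrow> cross2 (to_plane v) p - 0 * cross2 (to_plane v) d) (at_right 0)"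
      by (intro tendsto_intros)+
    then have "\<forall>\<^sub>F \<epsilon> in at_right 0. cross2 (to_plane v) p + \<epsilon> * cross2 (to_plane v) d > - of_int (height m v)"
      "\<forall>\<^sub>F \<epsilon> in at_right 0. cross2 (to_plane v) p - \<epsilon> * cross2 (to_plane v) d > - of_int (height m v)"
      using gt by (auto dest: order_tendstoD(1))
    then show ?thesis by eventually_elim simp
  qed
  then have "\<forall>\<^sub>F \<epsilon> in at_right 0. \<forall>v\<in>V. ?Q \<epsilon> v" using fin by (simp add: eventually_ball_finite)
  moreover have "\<forall>\<^sub>F \<epsilon> in at_right (0::real). \<epsilon> > 0" by (simp add: eventually_at_right_less)
  ultimately have "\<forall>\<^sub>F \<epsilon> in at_right 0. \<epsilon> > 0 \<and> (\<forall>v\<in>V. ?Q \<epsilon> v)" by eventually_elim blast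
  then obtain \<epsilon> where "\<epsilon> > 0" "\<forall>v\<in>V. ?Q \<epsilon> v"
    using eventually_happens'[OF trivial_limit_at_right_real] by blast
  then show ?thesis using that by (simp add: zpoly_def)
qed

text \<open>At a vertex two nonparallel constraints are tight, for otherwise it could be moved both
  ways along a common direction. Cramer's rule then locates it with denominator
  \<open>icross u w\<close>, which divides \<open>m\<close> and hence both heights.\<close>

lemma extreme_zpoly:
  assumes dvd: "\<And>u w. u \<in> V \<Longrightarrow> w \<in> V \<Longrightarrow> icross u w \<noteq> 0 \<Longrightarrow> icross u w dvd m"
    and p: "p extreme_point_of zpoly m"
  shows "p \<in> lattice"
proof -
  define Act where "Act = {v \<in> V. cross2 (to_plane v) p = - of_int (height m v)}"
  have pP: "p \<in> zpoly m" using p by (simp add: extreme_point_of_def)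
  have "\<exists>u\<in>Act. \<exists>w\<in>Act. icross u w \<noteq> 0"
  proof (rule ccontr)
    assume c: "\<not> (\<exists>u\<in>Act. \<exists>w\<in>Act. icross u w \<noteq> 0)"
    obtain y where y: "y \<in> V" "Act \<noteq> {} \<Longrightarrow> y \<in> Act"
      using nonempty by (metis (no_types, lifting) Act_def equals0I mem_Collect_eq)
    define d where "d = to_plane y"
    have d0: "d \<noteq> 0" using nonzero[OF y(1)] to_plane_inject[of y 0] by (simp add: d_def)
    obtain \<epsilon> where \<epsilon>: "\<epsilon> > 0" "p + \<epsilon> *\<^sub>R d \<in> zpoly m" "p - \<epsilon> *\<^sub>R d \<in> zpoly m"
    proof (rule zpoly_perturb[OF pP])
      fix v assume "v \<in> V" "cross2 (to_plane v) p = - of_int (height m v)"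
      then have "v \<in> Act" by (simp add: Act_def)
      then show "cross2 (to_plane v) d = 0" using c y(2) by (auto simp: d_def)
    qed
    have "p = midpoint (p + \<epsilon> *\<^sub>R d) (p - \<epsilon> *\<^sub>R d)" by (simp add: midpoint_def flip: scaleR_2)
    then have "p \<in> open_segment (p + \<epsilon> *\<^sub>R d) (p - \<epsilon> *\<^sub>R d)"
    proof -
      have "p + \<epsilon> *\<^sub>R d \<noteq> p - \<epsilon> *\<^sub>R d"
      proof
        assume "p + \<epsilon> *\<^sub>R d = p - \<epsilon> *\<^sub>R d"
        moreover have "(p + \<epsilon> *\<^sub>R d) - (p - \<epsilon> *\<^sub>R d) = \<epsilon> *\<^sub>R d + \<epsilon> *\<^sub>R d" by simp
        ultimately have "(\<epsilon> + \<epsilon>) *\<^sub>R d = 0" by (metis diff_self scaleR_left_distrib)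
        then show False using \<epsilon>(1) d0 by simp
      qed
      then show ?thesis using \<open>p = midpoint _ _\<close> by (metis midpoint_in_open_segment)
    qed
    then show False using p \<epsilon> unfolding extreme_point_of_def by blast
  qed
  then obtain u w where u: "u \<in> V" "cross2 (to_plane u) p = - of_int (height m u)"
    and w: "w \<in> V" "cross2 (to_plane w) p = - of_int (height m w)" and uw: "icross u w \<noteq> 0"
    by (auto simp: Act_def)
  let ?c = "icross u w"
  have "?c dvd m" by (rule dvd[OF u(1) w(1) uw])
  then have dv: "?c dvd height m u" "?c dvd height m w" by (simp_all add: height_def)
  then obtain a b where a: "height m u = ?c * a" and b: "height m w = ?c * b" by (elim dvdE)
  have "of_int ?c *\<^sub>R p = cross2 (to_plane u) p *\<^sub>R to_plane w - cross2 (to_plane w) p *\<^sub>R to_plane u"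
    unfolding cross2_to_plane[symmetric] by (simp add: cross2_def prod_eq_iff algebra_simps)
  also have "\<dots> = of_int ?c *\<^sub>R to_plane (zmul b u - zmul a w)"
    unfolding u(2) w(2) a b by (simp add: algebra_simps)
  finally have "p = to_plane (zmul b u - zmul a w)" using uw by simp
  then show ?thesis by blast
qed

text \<open>The face on which the constraint of \<open>v\<close> is tight is a compact convex part
  of a line, hence a segment; it is no single point because it contains the zonotope edge about
  \<open>zpoint m v\<close>.\<close>

lemma zpoly_edge:
  assumes b: "bounded (zpoly m)" and v: "v \<in> V" and m: "m > 0"
  shows "\<exists>a b. \<exists>c>0. oriented_edge (zpoly m) a b \<and> b - a = c *\<^sub>R to_plane v"
proof -
  let ?P = "zpoly m" and ?v = "to_plane v" and ?h = "- real_of_int (height m v)"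
  have v0: "?v \<noteq> 0" using nonzero[OF v] to_plane_inject[of v 0] by simp
  have convP: "convex ?P" using polyhedron_zpoly polyhedron_imp_convex by blast
  define F where "F = ?P \<inter> {q. (- snd ?v, fst ?v) \<bullet> q = ?h}"
  have F: "q \<in> F \<longleftrightarrow> q \<in> ?P \<and> cross2 ?v q = ?h" for q by (simp add: F_def cross2_eq_inner)
  have face: "F face_of ?P"
    unfolding F_def
    by (rule face_of_Int_supporting_hyperplane_ge[OF convP])
       (use v in \<open>simp add: zpoly_def flip: cross2_eq_inner\<close>)
  have in_F: "to_plane (zpoint m v) + t *\<^sub>R ?v \<in> F" if "\<bar>t\<bar> \<le> of_int m" for t
    unfolding F using zpoint_in_zpoly[OF v _ that] m by (simp add: zpoint_on_line)
  have x: "to_plane (zpoint m v) \<in> F" "to_plane (zpoint m v) + ?v \<in> F"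
    using in_F[of 0] in_F[of 1] m by simp_all
  have "compact ?P" using b polyhedron_imp_closed[OF polyhedron_zpoly] by (simp add: compact_eq_bounded_closed)
  then have cF: "compact F" using face face_of_imp_compact[OF convP] by blast
  have col: "collinear F"
    unfolding collinear_def
  proof (rule exI[of _ ?v], intro ballI)
    fix x y assume "x \<in> F" "y \<in> F"
    then have "cross2 ?v (x - y) = 0" by (simp add: F)
    then show "\<exists>c. x - y = c *\<^sub>R ?v" using parallel_if_cross2_zero[OF v0] by metis
  qed
  obtain a b where ab: "F = closed_segment a b"
    using compact_convex_collinear_segment[OF _ cF face_of_imp_convex[OF face] col] x(1) by blast
  have "a \<noteq> b"
  proof
    assume "a = b"
    then have "F = {a}" by (simp add: ab)
    then have "to_plane (zpoint m v) = to_plane (zpoint m v) + ?v" using x by (metis singletonD)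
    then show False using v0 by simp
  qed
  have edge: "closed_segment a b edge_of ?P"
    using face \<open>a \<noteq> b\<close> unfolding ab edge_of_def by (simp add: segment_convex_hull aff_dim_convex_hull)
  have abF: "a \<in> F" "b \<in> F" by (simp_all add: ab)
  have left: "?P \<subseteq> left_halfplane x (c *\<^sub>R ?v)" if "x \<in> F" "c > 0" for x c
  proof
    fix q assume "q \<in> ?P"
    then have "cross2 ?v q \<ge> ?h" using v by (simp add: zpoly_def)
    then have "cross2 ?v (q - x) \<ge> 0" using that(1) by (simp add: F)
    then show "q \<in> left_halfplane x (c *\<^sub>R ?v)"
      using that(2) by (simp add: left_halfplane_def zero_le_mult_iff del: cross2_simps(5))
  qed
  have "cross2 ?v (b - a) = 0" using abF by (simp add: F)
  then obtain t where t: "b - a = t *\<^sub>R ?v" using parallel_if_cross2_zero[OF v0] by blast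
  show ?thesis
  proof (cases "t > 0")
    case True
    have "oriented_edge ?P a b"
      unfolding oriented_edge_def using edge \<open>a \<noteq> b\<close> left[OF abF(1) True] t by simp
    then show ?thesis using t True by blast
  next
    case False
    have "t \<noteq> 0" using t \<open>a \<noteq> b\<close> by auto
    with False have t': "- t > 0" by simp
    have ba: "a - b = (- t) *\<^sub>R ?v" using t by (simp add: algebra_simps)
    have "oriented_edge ?P b a"
      unfolding oriented_edge_def ba using edge \<open>a \<noteq> b\<close> left[OF abF(2) t'] by (simp add: closed_segment_commute)
    then show ?thesis using ba t' by blast
  qed
qed

text \<open>Some constraint is tight at the midpoint of the edge, and then at both ends, so the edge
  is parallel to its \<open>v\<close>. As the origin is strictly inside, the orientations
  match.\<close>

lemma edge_zpoly:
  assumes pos: "\<And>v. v \<in> V \<Longrightarrow> height m v > 0" and e: "oriented_edge (zpoly m) a b"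
  shows "\<exists>v\<in>V. \<exists>c>0. b - a = c *\<^sub>R to_plane v"
proof -
  define d where "d = b - a"
  define p where "p = midpoint a b"
  have d0: "d \<noteq> 0" and sub: "closed_segment a b \<subseteq> zpoly m" and left: "zpoly m \<subseteq> left_halfplane a d"
    using e by (auto simp: oriented_edge_def d_def edge_of_imp_subset)
  have abP: "a \<in> zpoly m" "b \<in> zpoly m" using sub by auto
  have pP: "p \<in> zpoly m" using sub midpoint_in_closed_segment[of a b] by (auto simp: p_def)
  have pa: "p = a + (1/2) *\<^sub>R d"
    by (simp add: p_def d_def midpoint_def scaleR_right_distrib scaleR_right_diff_distrib) (simp add: algebra_simps flip: scaleR_left_distrib)
  have "\<exists>v\<in>V. cross2 (to_plane v) p = - of_int (height m v)"
  proof (rule ccontr)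
    assume c: "\<not> (\<exists>v\<in>V. cross2 (to_plane v) p = - of_int (height m v))"
    \<comment> \<open>\<open>f\<close> points to the left of the edge; with all constraints slack, a
      small step against it would stay in the polygon and yet cross the edge line.\<close>
    obtain f where f: "cross2 d (to_plane f) > 0" using lattice_cross2_unbounded[OF d0] .
    obtain \<epsilon> where \<epsilon>: "\<epsilon> > 0" "p - \<epsilon> *\<^sub>R to_plane f \<in> zpoly m"
      using zpoly_perturb[OF pP] c by blast
    then have "cross2 d (p - \<epsilon> *\<^sub>R to_plane f - a) \<ge> 0" using left by (auto simp: left_halfplane_def)
    then have "\<epsilon> * cross2 d (to_plane f) \<le> 0" by (simp add: pa)
    then show False using \<epsilon>(1) f by (simp add: mult_le_0_iff)
  qed
  then obtain v where v: "v \<in> V" "cross2 (to_plane v) p = - of_int (height m v)" by blast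
  have v0: "to_plane v \<noteq> 0" using nonzero[OF v(1)] to_plane_inject[of v 0] by simp
  have ge: "cross2 (to_plane v) a \<ge> - of_int (height m v)" "cross2 (to_plane v) b \<ge> - of_int (height m v)"
    using abP v(1) by (auto simp: zpoly_def)
  have mid: "2 * cross2 (to_plane v) p = cross2 (to_plane v) a + cross2 (to_plane v) b"
    by (simp add: pa d_def field_simps)
  have "cross2 (to_plane v) a = - of_int (height m v)" using ge mid v(2) by linarith
  moreover have "cross2 (to_plane v) b - cross2 (to_plane v) a = 0" using ge mid v(2) by linarith
  ultimately have on: "cross2 (to_plane v) a = - of_int (height m v)" "cross2 (to_plane v) d = 0"
    by (simp_all add: d_def)
  obtain t where t: "d = t *\<^sub>R to_plane v" using parallel_if_cross2_zero[OF v0 on(2)] .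
  have "t > 0"
  proof -
    have "0 \<in> zpoly m" using pos by (force simp: zpoly_def)
    then have "cross2 d (0 - a) \<ge> 0" using left by (auto simp: left_halfplane_def)
    then have "t * of_int (height m v) \<ge> 0" unfolding t using on(1) by simp
    moreover have "t \<noteq> 0" using t d0 by auto
    ultimately show ?thesis using pos[OF v(1)] by (simp add: zero_le_mult_iff)
  qed
  moreover have "b - a = t *\<^sub>R to_plane v" using t unfolding d_def .
  ultimately show ?thesis using v(1) by blast
qed

text \<open>The line through \<open>p\<close> along \<open>v\<close> carries the midpoint of the
  zonotope edge, with \<open>m\<close> steps on either side of it in the polygon. Walking from
  \<open>p\<close> towards that midpoint and beyond leaves room for \<open>m \<ge> N\<close>
  steps.\<close>

lemma zpoly_long_edge:
  assumes v: "v \<in> V" and N: "int N \<le> m"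
    and p: "p \<in> zpoly m" and min: "\<And>q. q \<in> zpoly m \<Longrightarrow> cross2 (to_plane v) (q - p) \<ge> 0"
  shows "\<exists>\<sigma>. (\<sigma> = 1 \<or> \<sigma> = -1) \<and>
      (\<forall>t. 1 \<le> t \<longrightarrow> t \<le> int N \<longrightarrow> p + to_plane (zmul (\<sigma> * t) v) \<in> zpoly m)"
proof -
  let ?x = "to_plane (zpoint m v)" and ?v = "to_plane v"
  have m: "m \<ge> 0" using N by linarith
  have v0: "?v \<noteq> 0" using nonzero[OF v] to_plane_inject[of v 0] by simp
  have x: "?x + t *\<^sub>R ?v \<in> zpoly m" if "\<bar>t\<bar> \<le> of_int m" for t
    by (rule zpoint_in_zpoly[OF v m that])
  have "cross2 ?v p \<ge> - of_int (height m v)" using p v by (simp add: zpoly_def)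
  moreover have "cross2 ?v (?x - p) \<ge> 0" using min[of ?x] x[of 0] m by simp
  ultimately have "cross2 ?v (p - ?x) = 0" by (simp add: zpoint_on_line)
  then obtain s where "p - ?x = s *\<^sub>R ?v" using parallel_if_cross2_zero[OF v0] by blast
  then have s: "p = ?x + s *\<^sub>R ?v" by (simp add: algebra_simps)
  have sP: "?x + s *\<^sub>R ?v \<in> zpoly m" using p s by simp
  have conv: "convex (zpoly m)" using polyhedron_zpoly polyhedron_imp_convex by blast
  show ?thesis
  proof (cases "s \<le> 0")
    case True
    have "p + to_plane (zmul (1 * t) v) \<in> zpoly m" if t: "1 \<le> t" "t \<le> int N" for t
    proof -
      have "real_of_int t \<le> of_int m" using t N by simp
      then have "?x + (s + of_int t) *\<^sub>R ?v \<in> zpoly m"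
        by (intro convex_line_between[OF conv sP x[of "of_int m"]]) (use True t m in auto)
      moreover have "?x + (s + of_int t) *\<^sub>R ?v = p + to_plane (zmul (1 * t) v)"
        by (simp add: s scaleR_left_distrib)
      ultimately show ?thesis by simp
    qed
    then show ?thesis by (intro exI[of _ 1]) blast
  next
    case False
    have "p + to_plane (zmul (-1 * t) v) \<in> zpoly m" if t: "1 \<le> t" "t \<le> int N" for t
    proof -
      have "real_of_int t \<le> of_int m" using t N by simp
      then have "?x + (s - of_int t) *\<^sub>R ?v \<in> zpoly m"
        by (intro convex_line_between[OF conv x[of "- of_int m"] sP]) (use False t m in auto)
      moreover have "?x + (s - of_int t) *\<^sub>R ?v = p + to_plane (zmul (-1 * t) v)"
        by (simp add: s scaleR_left_diff_distrib)
      ultimately show ?thesis by simp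
    qed
    then show ?thesis by (intro exI[of _ "-1"]) blast
  qed
qed

lemma edge_polygon_exists:
  assumes "N > 0"
  shows "\<exists>P. edge_polygon N P"
proof (cases "\<exists>u\<in>V. \<exists>v\<in>V. icross u v \<noteq> 0")
  case False
  then show ?thesis using edge_polygon_segment[OF assms] by blast
next
  case True
  then obtain u w where uw: "u \<in> V" "w \<in> V" "icross u w \<noteq> 0" by blast
  define C where "C = {c \<in> (\<lambda>(x, y). icross x y) ` (V \<times> V). c \<noteq> 0}"
  have C: "finite C" "0 \<notin> C" using fin by (auto simp: C_def)
  \<comment> \<open>Divisible by every nonzero cross product, for integral vertices, and at least
    \<open>N\<close>, for long edges.\<close>
  define m where "m = int N * \<bar>\<Prod>C\<bar>"
  have "\<bar>\<Prod>C\<bar> > 0" using C by (simp add: prod_zero_iff)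
  then have "1 \<le> \<bar>\<Prod>C\<bar>" by linarith
  then have "int N * 1 \<le> m" unfolding m_def by (intro mult_left_mono) auto
  then have m: "m > 0" "int N \<le> m" using assms by auto
  have dvd: "icross x y dvd m" if "x \<in> V" "y \<in> V" "icross x y \<noteq> 0" for x y
  proof -
    have "icross x y \<in> C" using that by (force simp: C_def)
    then have "icross x y dvd \<Prod>C" using dvd_prodI[OF C(1), of _ "\<lambda>x. x"] by simp
    then show ?thesis by (simp add: m_def)
  qed
  have pos: "height m v > 0" if v: "v \<in> V" for v
  proof -
    have "\<exists>x\<in>V. icross v x \<noteq> 0"
    proof (rule ccontr)
      assume c: "\<not> (\<exists>x\<in>V. icross v x \<noteq> 0)"
      then have "u = v \<or> u = - v" "w = v \<or> w = - v" using parallel[OF v] uw by blast+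
      then show False using uw(3) by auto
    qed
    then obtain x where x: "x \<in> V" "icross v x \<noteq> 0" by blast
    have "\<bar>icross v x\<bar> \<le> (\<Sum>u\<in>V. \<bar>icross v u\<bar>)" using x(1) fin by (intro member_le_sum) auto
    then show ?thesis using x(2) m(1) by (simp add: height_def)
  qed
  have bd: "bounded (zpoly m)" by (rule bounded_zpoly[OF uw])
  have poly: "polytope (zpoly m)" using bd polyhedron_zpoly polytope_eq_bounded_polyhedron by blast
  have "edge_polygon N (zpoly m)"
    unfolding edge_polygon_def
  proof (intro conjI ballI allI impI)
    obtain a b c where "oriented_edge (zpoly m) a b" using zpoly_edge[OF bd uw(1) m(1)] by blast
    then have "closed_segment a b \<subseteq> zpoly m" "aff_dim (closed_segment a b) = 1"
      unfolding oriented_edge_def edge_of_def using face_of_imp_subset by auto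
    then have "aff_dim (zpoly m) \<ge> 1" by (metis aff_dim_subset)
    then show "convex_integer_polygon (zpoly m)"
      unfolding convex_integer_polygon_def using poly extreme_zpoly[OF dvd] by blast
  next
    fix v assume "v \<in> V"
    then show "\<exists>a b. \<exists>c>0. oriented_edge (zpoly m) a b \<and> b - a = c *\<^sub>R to_plane v"
      using zpoly_edge[OF bd _ m(1)] by blast
  next
    fix a b assume "oriented_edge (zpoly m) a b"
    then show "\<exists>v\<in>V. \<exists>c>0. b - a = c *\<^sub>R to_plane v" using edge_zpoly[OF pos] by blast
  next
    fix v p assume "v \<in> V" "p extreme_point_of zpoly m" "\<forall>q\<in>zpoly m. 0 \<le> cross2 (to_plane v) (q - p)"
    then show "\<exists>\<sigma>. (\<sigma> = 1 \<or> \<sigma> = -1) \<and>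
          (\<forall>t. 1 \<le> t \<longrightarrow> t \<le> int N \<longrightarrow> p + to_plane (zmul (\<sigma> * t) v) \<in> zpoly m)"
      by (intro zpoly_long_edge[OF _ m(2)]) (auto simp: extreme_point_of_def)
  qed
  then show ?thesis by blast
qed

end

section \<open>The recoding\<close>

lemma segment_parallel_ray_if_parallel:
  assumes "c > 0" "b - a = c *\<^sub>R v" "v \<noteq> 0"
  shows "segment_parallel_ray a b (ray p v)"
  unfolding segment_parallel_ray_def
  by (intro exI[of _ p] exI[of _ v] exI[of _ "p - a"] exI[of _ 0] exI[of _ c])
     (use assms in \<open>auto simp: algebra_simps\<close>)

section \<open>Lattice points control the polygon\<close>

lemma extreme_point_in_lattice:
  "convex_integer_polygon P \<Longrightarrow> x extreme_point_of P \<Longrightarrow> x \<in> P \<and> x \<in> lattice"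
  unfolding convex_integer_polygon_def extreme_point_of_def by blast

text \<open>The centres are lattice points, whereas the long edge property speaks of all of
  \<open>P\<close>; the passage is possible because \<open>P\<close> is the convex hull of its
  vertices and these are lattice points.\<close>

lemma supporting_if_lattice:
  assumes P: "convex_integer_polygon P"
    and le: "\<And>u. to_plane u \<in> P \<Longrightarrow> cross2 v (to_plane u - p) \<ge> 0" and q: "q \<in> P"
  shows "cross2 v (q - p) \<ge> 0"
proof -
  have "compact P" "convex P"
    using P by (auto simp: convex_integer_polygon_def polytope_imp_compact polytope_imp_convex)
  then have "P = convex hull {x. x extreme_point_of P}" by (rule Krein_Milman_Minkowski)
  also have "\<dots> \<subseteq> {q. (- snd v, fst v) \<bullet> q \<ge> cross2 v p}"
  proof (rule hull_minimal)
    show "{x. x extreme_point_of P} \<subseteq> {q. (- snd v, fst v) \<bullet> q \<ge> cross2 v p}"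
    proof
    fix x assume "x \<in> {x. x extreme_point_of P}"
    then have "x \<in> P" "x \<in> lattice" using extreme_point_in_lattice[OF P] by auto
    then have "cross2 v (x - p) \<ge> 0" using le by blast
    then show "x \<in> {q. (- snd v, fst v) \<bullet> q \<ge> cross2 v p}" by (simp flip: cross2_eq_inner)
    qed
  qed (rule convex_halfspace_ge)
  finally show ?thesis using q by (auto simp flip: cross2_eq_inner)
qed

lemma polygon_other_lattice_point:
  assumes P: "convex_integer_polygon P"
  obtains u where "to_plane u \<in> P" "to_plane u \<noteq> p"
proof -
  have "compact P" "convex P" and dim: "aff_dim P \<ge> 1"
    using P by (auto simp: convex_integer_polygon_def polytope_imp_compact polytope_imp_convex)
  then have hull: "P = convex hull {x. x extreme_point_of P}" by (intro Krein_Milman_Minkowski)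
  have "\<not> {x. x extreme_point_of P} \<subseteq> {p}"
  proof
    assume "{x. x extreme_point_of P} \<subseteq> {p}"
    then have "P \<subseteq> convex hull {p}" by (subst hull) (rule hull_mono)
    then have "aff_dim P \<le> aff_dim {p}" by (intro aff_dim_subset) simp
    with dim show False by simp
  qed
  then obtain x where "x extreme_point_of P" "x \<noteq> p" by blast
  moreover from this have "x \<in> P" "x \<in> lattice" using extreme_point_in_lattice[OF P] by auto
  ultimately show ?thesis using that by blast
qed

lemma (in direction_set) edge_polygonD:
  assumes "edge_polygon N P"
  shows "convex_integer_polygon P"
    and "v \<in> V \<Longrightarrow> \<exists>a b. \<exists>c>0. oriented_edge P a b \<and> b - a = c *\<^sub>R to_plane v"
    and "oriented_edge P a b \<Longrightarrow> \<exists>v\<in>V. \<exists>c>0. b - a = c *\<^sub>R to_plane v"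
    and "v \<in> V \<Longrightarrow> p extreme_point_of P \<Longrightarrow> (\<And>q. q \<in> P \<Longrightarrow> cross2 (to_plane v) (q - p) \<ge> 0) \<Longrightarrow>
       \<exists>\<sigma>. (\<sigma> = 1 \<or> \<sigma> = -1) \<and>
          (\<forall>t. 1 \<le> t \<longrightarrow> t \<le> int N \<longrightarrow> p + to_plane (zmul (\<sigma> * t) v) \<in> P)"
  using assms unfolding edge_polygon_def by blast+

context closing_shift
begin

lemma direction_set_nonexp: "nonexp X \<noteq> {} \<Longrightarrow> direction_set (nonexp X)"
proof (unfold_locales)
  fix v assume "v \<in> nonexp X"
  from nonexp_balanced[OF this] show "\<exists>a\<in>nonexp X. \<exists>b\<in>nonexp X. \<exists>\<alpha>\<ge>0. \<exists>\<beta>\<ge>0. \<exists>\<gamma>>0.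
      zmul \<gamma> v + zmul \<alpha> a + zmul \<beta> b = 0"
    by metis
qed (use fin nonexp_nonzero nonexp_parallel in auto)

lemma polygon_coding_recoding:
  assumes ne: "nonexp X \<noteq> {}"
  obtains B :: "nat set" and Y P N where
    "recoding A X B Y" "coding_polygon Y P" "direction_set.edge_polygon (nonexp X) N P"
proof -
  interpret direction_set "nonexp X" by (rule direction_set_nonexp[OF ne])
  obtain N :: nat where N: "N > 0" "\<And>v \<sigma> K. v \<in> nonexp X \<Longrightarrow> \<sigma> = 1 \<or> \<sigma> = -1 \<Longrightarrow>
        (\<And>t. 1 \<le> t \<Longrightarrow> t \<le> int N \<Longrightarrow> zmul (\<sigma> * t) v \<in> K) \<Longrightarrow>
        icodes X ({w. icross v w > 0} \<union> K) {0}"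
    using uniform_closing by blast
  obtain P where P: "edge_polygon N P" using edge_polygon_exists[OF N(1)] by blast
  note cip = edge_polygonD(1)[OF P] and long = edge_polygonD(4)[OF P]
  have poly: "polytope P" using cip by (simp add: convex_integer_polygon_def)
  \<comment> \<open>The lattice points of \<open>P\<close> other than \<open>p\<close>, seen from
    \<open>p\<close>: the disc centres at this vertex.\<close>
  define Z where "Z p = {z. to_plane (p + z) \<in> P \<and> z \<noteq> 0}" for p
  have "\<forall>\<^sub>F r in at_top. icodes X (\<Union>z\<in>Z p. (+) z ` disc r) (disc r)"
    if p: "to_plane p extreme_point_of P" for p
  proof (rule disc_coding_closing[OF _ _ _ N])
    have "Z p \<subseteq> (\<lambda>u. u - p) ` {u. to_plane u \<in> P}"
    proof
      fix z assume "z \<in> Z p"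
      then have "p + z \<in> {u. to_plane u \<in> P}" by (simp add: Z_def)
      then have "(p + z) - p \<in> (\<lambda>u. u - p) ` {u. to_plane u \<in> P}" by (rule imageI)
      then show "z \<in> (\<lambda>u. u - p) ` {u. to_plane u \<in> P}" by simp
    qed
    then show "finite (Z p)"
      using finite_lattice_bounded[OF polytope_imp_bounded[OF poly]] by (meson finite_imageI finite_subset)
    obtain u where "to_plane u \<in> P" "to_plane u \<noteq> to_plane p"
      using polygon_other_lattice_point[OF cip] .
    then have "u - p \<in> Z p" by (auto simp: Z_def)
    then show "Z p \<noteq> {}" by blast
    fix v assume v: "v \<in> nonexp X" and pos: "\<And>z. z \<in> Z p \<Longrightarrow> icross v z \<ge> 0"
    have "cross2 (to_plane v) (q - to_plane p) \<ge> 0" if "q \<in> P" for q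
    proof (rule supporting_if_lattice[OF cip _ that])
      fix u assume u: "to_plane u \<in> P"
      have "icross v (u - p) \<ge> 0"
      proof (cases "u = p")
        case False
        with u have "u - p \<in> Z p" by (simp add: Z_def)
        then show ?thesis by (rule pos)
      qed simp
      then have "cross2 (to_plane v) (to_plane (u - p)) \<ge> 0" unfolding cross2_to_plane by simp
      then show "cross2 (to_plane v) (to_plane u - to_plane p) \<ge> 0" by (simp only: to_plane_simps)
    qed
    then obtain \<sigma> where \<sigma>: "\<sigma> = 1 \<or> \<sigma> = -1"
        "\<And>t. 1 \<le> t \<Longrightarrow> t \<le> int N \<Longrightarrow> to_plane p + to_plane (zmul (\<sigma> * t) v) \<in> P"
      using long[OF v p] by blast
    have "zmul (\<sigma> * t) v \<in> Z p" if "1 \<le> t" "t \<le> int N" for t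
    proof -
      have "zmul (\<sigma> * t) v \<noteq> 0" using nonexp_nonzero[OF v] \<sigma>(1) that by (auto simp: zmul_def prod_eq_iff)
      moreover have "to_plane (p + zmul (\<sigma> * t) v) \<in> P" using \<sigma>(2)[OF that] by (simp only: to_plane_simps)
      ultimately show ?thesis by (simp add: Z_def)
    qed
    then show "\<exists>\<sigma>. (\<sigma> = 1 \<or> \<sigma> = -1) \<and> (\<forall>t. 1 \<le> t \<longrightarrow> t \<le> int N \<longrightarrow> zmul (\<sigma> * t) v \<in> Z p)"
      using \<sigma>(1) by blast
  qed
  moreover have "finite {p. to_plane p extreme_point_of P}"
    by (rule finite_subset[OF _ finite_lattice_bounded[OF polytope_imp_bounded[OF poly]]])
       (auto simp: extreme_point_of_def)
  ultimately have "\<forall>\<^sub>F r in at_top. \<forall>p\<in>{p. to_plane p extreme_point_of P}.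
      icodes X (\<Union>z\<in>Z p. (+) z ` disc r) (disc r)"
    by (intro eventually_ball_finite) auto
  then obtain r where r: "r \<ge> 0" and cod: "\<And>p. to_plane p extreme_point_of P \<Longrightarrow>
      icodes X (\<Union>z\<in>Z p. (+) z ` disc r) (disc r)"
    unfolding eventually_at_top_linorder by (metis (no_types, lifting) mem_Collect_eq nle_le)
  have "0 \<in> disc r" using r by (simp add: disc_def)
  then obtain B :: "nat set" and \<Psi> where rec: "recoding A X B (\<Psi> ` X)" "inj_on \<Psi> X"
    and \<Psi>: "\<And>u x x'. x \<in> X \<Longrightarrow> x' \<in> X \<Longrightarrow> \<Psi> x u = \<Psi> x' u \<longleftrightarrow> (\<forall>f\<in>disc r. x (f + u) = x' (f + u))"
    using block_recoding[OF X finite_disc] by blast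
  have "coding_polygon (\<Psi> ` X) P"
    unfolding coding_polygon_def
  proof (intro conjI allI impI)
    obtain v where "v \<in> nonexp X" using ne by blast
    then have "to_plane v \<noteq> 0" "\<not> expansive X (left_halfplane 0 (to_plane v))"
      using to_plane_nonzero by (simp_all add: nonexp_def)
    then have "infinite X" by (rule infinite_if_nonexpansive[OF X])
    then show "infinite (\<Psi> ` X)" using rec(2) by (simp add: finite_image_iff)
    show "convex_integer_polygon P" by (rule cip)
    fix q assume q: "q extreme_point_of P"
    then obtain p where p: "q = to_plane p" using extreme_point_in_lattice[OF cip] by blast
    show "codes (\<Psi> ` X) (P - {q}) {q}"
      unfolding codes_eq_icodes icodes_def
    proof (intro ballI impI)
      fix y y' u assume y: "y \<in> \<Psi> ` X" "y' \<in> \<Psi> ` X" and ag: "\<forall>u\<in>to_plane -` (P - {q}). y u = y' u"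
        and "u \<in> to_plane -` {q}"
      then have u: "u = p" by (simp add: p)
      obtain x x' where x: "x \<in> X" "x' \<in> X" "y = \<Psi> x" "y' = \<Psi> x'" using y by blast
      \<comment> \<open>Equality of symbols at \<open>p\<close> is agreement on the disc about
        \<open>p\<close>, and the symbols known at the other lattice points of \<open>P\<close> give
        agreement on the discs about all \<open>p + z\<close>.\<close>
      have "x (p + f) = x' (p + f)" if f: "f \<in> disc r" for f
      proof (rule icodesD[OF icodes_translate[OF X cod] x(1,2)])
        show "to_plane p extreme_point_of P" using q p by simp
        show "p + f \<in> (+) p ` disc r" using f by blast
        fix w assume "w \<in> (+) p ` (\<Union>z\<in>Z p. (+) z ` disc r)"
        then obtain z g where z: "z \<in> Z p" "g \<in> disc r" "w = p + (z + g)" by blast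
        have "p + z \<in> to_plane -` (P - {q})" using z(1) by (simp add: Z_def p del: to_plane_simps)
        then have "\<Psi> x (p + z) = \<Psi> x' (p + z)" using ag x by blast
        then have "x (g + (p + z)) = x' (g + (p + z))" using \<Psi>[OF x(1,2)] z(2) by blast
        then show "x w = x' w" by (simp add: z(3) algebra_simps)
      qed
      then have "\<Psi> x p = \<Psi> x' p" using \<Psi>[OF x(1,2)] by (simp add: add.commute)
      then show "y u = y' u" by (simp add: x u)
    qed
  qed
  with rec(1) P that show ?thesis by blast
qed

end

theorem theorem5p12:
  fixes A :: "'a set" and X :: "'a config set"
  assumes "subshift A X"
    and "finite (nonexpansive_rays X // translation_rel)"
    and "nonexpansive_rays X \<noteq> {}"
    and "\<forall>l\<in>nonexpansive_rays X. rational_ray l \<and> closing_ray X l"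
  shows "\<exists>(B :: nat set) Y P.
           recoding A X B Y \<and> polygonal Y \<and> coding_polygon Y P \<and>
           (\<forall>a b. oriented_edge P a b \<longrightarrow>
              (\<exists>l\<in>nonexpansive_rays X. segment_parallel_ray a b l)) \<and>
           (\<forall>l\<in>nonexpansive_rays X. \<exists>a b. oriented_edge P a b \<and> segment_parallel_ray a b l)"
proof -
  have rational: "\<forall>l\<in>nonexpansive_rays X. rational_ray l" using assms(4) by blast
  interpret closing_shift A X
    using assms finite_nonexp by unfold_locales auto
  have ne: "nonexp X \<noteq> {}"
    using nonexpansive_ray_direction[OF X rational] assms(3) by blast
  interpret direction_set "nonexp X" by (rule direction_set_nonexp[OF ne])
  obtain B :: "nat set" and Y P N where rec: "recoding A X B Y" "coding_polygon Y P" and P: "edge_polygon N P"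
    by (rule polygon_coding_recoding[OF ne])
  have "polygonal Y" using rec(2) by (auto simp: polygonal_def coding_polygon_def)
  moreover have "\<exists>l\<in>nonexpansive_rays X. segment_parallel_ray a b l" if e: "oriented_edge P a b" for a b
  proof -
    obtain v c where v: "v \<in> nonexp X" "c > 0" "b - a = c *\<^sub>R to_plane v"
      using edge_polygonD(3)[OF P e] by blast
    then show ?thesis
      using nonexp_ray segment_parallel_ray_if_parallel[OF v(2,3)] to_plane_nonzero nonexp_coprime by blast
  qed
  moreover have "\<exists>a b. oriented_edge P a b \<and> segment_parallel_ray a b l" if l: "l \<in> nonexpansive_rays X" for l
  proof -
    obtain v p where v: "v \<in> nonexp X" "l = ray p (to_plane v)"
      using nonexpansive_ray_direction[OF X rational l] .
    then obtain a b c where "c > 0" "oriented_edge P a b" "b - a = c *\<^sub>R to_plane v"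
      using edge_polygonD(2)[OF P] by blast
    then show ?thesis
      using v segment_parallel_ray_if_parallel to_plane_nonzero nonexp_coprime by blast
  qed
  ultimately show ?thesis using rec by blast
qed

end
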